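(* Let $n\ge3$ and $x_0,x_n\in\mathbb{Z}^d$ with $x_0\ne x_n$, and let $U=U_{x_0,x_n}$ be the set of irreducible paths from $x_0$ to $x_n$. Then there is an absolute constant $C>1$ (in particular independent of $n,x_0,x_n,\epsilon$) such that $$|T^n_U(x_0,x_n)|\le C^{n\log n}\,\epsilon^{3-n}\,\langle x_0-x_n\rangle^{-3d+\epsilon}$$ for all sufficiently small $\epsilon>0$.
   Context: $\langle x\rangle=1+|x|$. Paths are vectors $\underline{x}=(x_1,\dots,x_{n-1})\in(\mathbb{Z}^d)^{n-1}$. The set of irreducible paths from $x_0$ to $x_n$ is $$U=U_{x_0,x_n}=\{\underline{x}\in(\mathbb{Z}^d)^{n-1}:\ \{x_0,\dots,x_j\}\cap\{x_{j+1},\dots,x_n\}\ne\emptyset\ \text{ for every }0\le j<n\}.$$ A singular integral operator (of convolution type) on $\mathbb{Z}^d$ is a Fourier multiplier operator $\widehat{Ku}(\theta)=m(\theta)\hat u(\theta)$ (with $\hat u(\theta)=\sum_x u(x)e^{-i\theta\cdot x}$) whose multiplier $m$ on $\mathbb{T}^d=[-\pi,\pi]^d$ satisfies $|\partial^\alpha m(\theta)|\le C_\alpha|\theta|^{-|\alpha|}$ for all multi-indices $\alpha$; $K(x)$ also denotes its convolution kernel. For $1\le j\le n$ let $K^j(x,y)=K_j(x-y)b_j(y)$ with $K_j$ a singular integral operator and $b_j$ a bounded function on $\mathbb{Z}^d$, where the constants $C_\alpha$ and the bound on $\|b_j\|_\infty$ are uniform in $j$ and $n$. For $S\subset(\mathbb{Z}^d)^{n-1}$,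 $$T^n_S(x_0,x_n)=\sum_{\underline{x}\in S}K^1(x_0,x_1)K^2(x_1,x_2)\cdots K^n(x_{n-1},x_n)$$ (an absolutely convergent sum). "Absolute" constants and the threshold for $\epsilon$ depend only on $d$, the $C_\alpha$ and the uniform bound on $\|b_j\|_\infty$. *)

theory Defs
  imports "HOL-Analysis.Analysis"
begin

definition real_vec :: "int ^ 'd::finite \<Rightarrow> real ^ 'd" where
  "real_vec x = (\<chi> i. real_of_int (x $ i))"

definition bracket :: "int ^ 'd::finite \<Rightarrow> real" where
  "bracket x = 1 + norm (real_vec x)"


section \<open>Fourier multipliers on the lattice\<close>

definition torus :: "(real ^ 'd::finite) set" where
  "torus = cbox (\<chi> i. - pi) (\<chi> i. pi)"

text \<open>The point 0 of the torus, lifted to its periodic copies.\<close>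

definition dual_lattice :: "(real ^ 'd::finite) set" where
  "dual_lattice = {\<theta>. \<forall>i. \<exists>k::int. \<theta> $ i = 2 * pi * of_int k}"

definition fourier :: "(int ^ 'd::finite \<Rightarrow> complex) \<Rightarrow> real ^ 'd \<Rightarrow> complex" where
  "fourier u \<theta> = (\<Sum>\<^sub>\<infinity>x. u x * cis (- (\<theta> \<bullet> real_vec x)))"

definition inverse_fourier :: "(real ^ 'd::finite \<Rightarrow> complex) \<Rightarrow> int ^ 'd \<Rightarrow> complex" where
  "inverse_fourier g x =
     (LINT \<theta>:torus|lborel. g \<theta> * cis (\<theta> \<bullet> real_vec x)) / (2 * of_real pi) ^ CARD('d)"

text \<open>The operator with \<open>fourier (K u) = m * fourier u\<close>. The formula is meaningful for absolutely
  summable \<open>u\<close>, which suffices: for a bounded multiplier these determine the operator on the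
  square-summable functions, and they include the point mass that yields the kernel.\<close>

definition fourier_multiplier ::
    "(real ^ 'd::finite \<Rightarrow> complex) \<Rightarrow> (int ^ 'd \<Rightarrow> complex) \<Rightarrow> int ^ 'd \<Rightarrow> complex" where
  "fourier_multiplier m u = inverse_fourier (\<lambda>\<theta>. m \<theta> * fourier u \<theta>)"

definition conv_kernel ::
    "((int ^ 'd::finite \<Rightarrow> complex) \<Rightarrow> int ^ 'd \<Rightarrow> complex) \<Rightarrow> int ^ 'd \<Rightarrow> complex" where
  "conv_kernel K = K (\<lambda>y. if y = 0 then 1 else 0)"


section \<open>Singular integral operators\<close>

definition partial_deriv ::
    "'d::finite \<Rightarrow> (real ^ 'd \<Rightarrow> complex) \<Rightarrow> real ^ 'd \<Rightarrow> complex" where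
  "partial_deriv i f \<theta> = vector_derivative (\<lambda>t. f (\<theta> + t *\<^sub>R axis i 1)) (at 0)"

fun partial_derivs ::
    "'d::finite list \<Rightarrow> (real ^ 'd \<Rightarrow> complex) \<Rightarrow> real ^ 'd \<Rightarrow> complex" where
  "partial_derivs [] f = f"
| "partial_derivs (i # l) f = partial_deriv i (partial_derivs l f)"

text \<open>Functions on the torus are periodic functions on the whole space, so smoothness away from 0
  includes smoothness across the boundary of the fundamental cube. Differentiability of all
  iterated partial derivatives (in any order) is smoothness. The list \<open>l\<close> stands for
  the multi-index \<open>\<alpha> = count_list l\<close> (\<open>\<alpha> i\<close> is the number of occurrences of \<open>i\<close>), with
  \<open>\<bar>\<alpha>\<bar> = length l\<close>; the order of differentiation in \<open>l\<close> is immaterial for smooth functions.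
  The value of \<open>m\<close> at 0 is unconstrained (a null set).\<close>

definition singular_multiplier ::
    "(('d::finite \<Rightarrow> nat) \<Rightarrow> real) \<Rightarrow> (real ^ 'd \<Rightarrow> complex) \<Rightarrow> bool" where
  "singular_multiplier C m \<longleftrightarrow>
     (\<forall>\<theta> i. m (\<theta> + (2 * pi) *\<^sub>R axis i 1) = m \<theta>) \<and>
     (\<forall>l. \<forall>\<theta>. \<theta> \<notin> dual_lattice \<longrightarrow> partial_derivs l m differentiable (at \<theta>)) \<and>
     (\<forall>l. \<forall>\<theta> \<in> torus - {0}.
        norm (partial_derivs l m \<theta>) \<le> C (count_list l) * norm \<theta> powr (- real (length l)))"

definition singular_integral_operator ::
    "(('d::finite \<Rightarrow> nat) \<Rightarrow> real) \<Rightarrow> ((int ^ 'd \<Rightarrow> complex) \<Rightarrow> int ^ 'd \<Rightarrow> complex) \<Rightarrow> bool" where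
  "singular_integral_operator C K \<longleftrightarrow>
     (\<exists>m. singular_multiplier C m \<and> K = fourier_multiplier m)"


section \<open>Path sums\<close>

text \<open>A path with \<open>n\<close> steps is given by its interior points, an element of
  \<open>{1..<n} \<rightarrow>\<^sub>E UNIV\<close>; \<open>vertex\<close> adds the endpoints.\<close>

definition vertex :: "nat \<Rightarrow> 'a \<Rightarrow> 'a \<Rightarrow> (nat \<Rightarrow> 'a) \<Rightarrow> nat \<Rightarrow> 'a" where
  "vertex n a b x j = (if j = 0 then a else if j = n then b else x j)"

definition paths :: "nat \<Rightarrow> (nat \<Rightarrow> 'a) set" where
  "paths n = {1..<n} \<rightarrow>\<^sub>E UNIV"

definition irreducible_paths :: "nat \<Rightarrow> 'a \<Rightarrow> 'a \<Rightarrow> (nat \<Rightarrow> 'a) set" where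
  "irreducible_paths n a b =
     {x \<in> paths n. \<forall>j<n. vertex n a b x ` {0..j} \<inter> vertex n a b x ` {Suc j..n} \<noteq> {}}"

definition weighted_kernel ::
    "((int ^ 'd::finite \<Rightarrow> complex) \<Rightarrow> int ^ 'd \<Rightarrow> complex) \<Rightarrow> (int ^ 'd \<Rightarrow> complex)
     \<Rightarrow> int ^ 'd \<Rightarrow> int ^ 'd \<Rightarrow> complex" where
  "weighted_kernel K b x y = conv_kernel K (x - y) * b y"

definition path_weight ::
    "(nat \<Rightarrow> (int ^ 'd::finite \<Rightarrow> complex) \<Rightarrow> int ^ 'd \<Rightarrow> complex) \<Rightarrow> (nat \<Rightarrow> int ^ 'd \<Rightarrow> complex)
     \<Rightarrow> nat \<Rightarrow> int ^ 'd \<Rightarrow> int ^ 'd \<Rightarrow> (nat \<Rightarrow> int ^ 'd) \<Rightarrow> complex" where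
  "path_weight K b n x0 xn x =
     (\<Prod>j\<in>{1..n}. weighted_kernel (K j) (b j) (vertex n x0 xn x (j - 1)) (vertex n x0 xn x j))"

definition path_sum ::
    "(nat \<Rightarrow> (int ^ 'd::finite \<Rightarrow> complex) \<Rightarrow> int ^ 'd \<Rightarrow> complex) \<Rightarrow> (nat \<Rightarrow> int ^ 'd \<Rightarrow> complex)
     \<Rightarrow> nat \<Rightarrow> (nat \<Rightarrow> int ^ 'd) set \<Rightarrow> int ^ 'd \<Rightarrow> int ^ 'd \<Rightarrow> complex" where
  "path_sum K b n S x0 xn = (\<Sum>\<^sub>\<infinity>x\<in>S. path_weight K b n x0 xn x)"

end

theory Submission
  imports Defs
begin

text \<open>
  The sum is bounded with absolute values inside: no cancellation between paths is used.

  \<^bold>\<open>Kernels.\<close> A multiplier whose derivatives are bounded like those of a function homogeneous of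
  degree 0 has a kernel of size \<open>M * bracket x powr - d\<close>, where \<open>d = CARD('d)\<close>
  (\<open>singular_kernel_decay\<close>). After this it remains to sum the products of
  \<open>bracket (x (e - 1) - x e) powr - d\<close> over irreducible paths \<open>x\<close>, where \<open>e\<close> runs through the
  edges \<open>1, \<dots>, n\<close> of the path.

  \<^bold>\<open>One path.\<close> View a path as a connected multigraph on the set of points that it visits, with the \<open>n\<close>
  steps as edges, weighted by their lengths. Choose a lightest set \<open>F\<close> of edges that joins every
  visited point to one of the two endpoints; this is a minimum spanning forest with two roots.
  Its two components give a cut between the endpoints. The path crosses this cut, hence an
  odd number of times, and irreducibility excludes a single crossing. So there are at least three
  edges across it, all outside \<open>F\<close>. By minimality of \<open>F\<close>, for each of them there is a chain of at most \<open>n\<close>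
  edges between the endpoints that are no longer than it, so its weight is at least
  \<open>bracket (x 0 - x n) / (n + 1)\<close>. They provide the power \<open>- 3 d\<close>. The other edges provide, up to the
  loss of \<open>\<epsilon>\<close> in that power, the product over \<open>F\<close> of the summable weights
  \<open>bracket z powr (- d - \<epsilon> / n)\<close>: any long edge of \<open>F\<close> is dominated by an edge outside \<open>F\<close>, because
  the path crosses each fundamental cut of \<open>F\<close> at least twice
  (\<open>irreducible_path_weight_bound\<close>).

  \<^bold>\<open>All paths.\<close> Group the paths by their pattern of coincidences among the vertices and by \<open>F\<close>. There
  are at most \<open>(n + 1) ^ (n + 1) * 2 ^ n\<close> groups, which is absorbed by the factor
  \<open>C powr (n ln n)\<close>. Inside a group, a path is determined by its increments along \<open>F\<close>, so the sum over the
  group is at most the product over \<open>F\<close> of the sums of \<open>bracket z powr (- d - \<epsilon> / n)\<close>, each of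
  which is of order \<open>n / \<epsilon>\<close> (\<open>lattice_sum_le\<close>). Since at least three edges lie outside \<open>F\<close>,
  this happens at most \<open>n - 3\<close> times, which is the power of \<open>\<epsilon>\<close> in the theorem.
\<close>

section \<open>Sums over the lattice\<close>

lemma bracket_ge_1: "1 \<le> bracket x" by (simp add: bracket_def)

lemma abs_component_le_bracket: "real_of_int \<bar>x $ i\<bar> \<le> bracket x"
  using component_le_norm_cart[of "real_vec x" i] by (simp add: bracket_def real_vec_def)

lemma card_lattice_cube:
  "finite {z :: int ^ 'd::finite. \<forall>i. \<bar>z $ i\<bar> \<le> int M}"
  "card {z :: int ^ 'd::finite. \<forall>i. \<bar>z $ i\<bar> \<le> int M} \<le> (2 * M + 1) ^ CARD('d)"
proof -
  let ?A = "{z :: int ^ 'd::finite. \<forall>i. \<bar>z $ i\<bar> \<le> int M}"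
  let ?B = "(UNIV :: 'd set) \<rightarrow>\<^sub>E {- int M..int M}"
  have inj: "inj_on (\<lambda>z. ($) z) ?A" by (auto simp: inj_on_def vec_eq_iff)
  have sub: "(\<lambda>z. ($) z) ` ?A \<subseteq> ?B" by (auto simp: abs_le_iff) (metis minus_le_iff)
  have finB: "finite ?B" by (intro finite_PiE) auto
  show "finite ?A" using finite_imageD[OF finite_subset[OF sub finB] inj] .
  have "card ?A \<le> card ?B" using card_inj_on_le[OF inj sub finB] .
  also have "\<dots> = (2 * M + 1) ^ CARD('d)" by (simp add: card_PiE nat_add_distrib nat_mult_distrib)
  finally show "card ?A \<le> (2 * M + 1) ^ CARD('d)" .
qed

text \<open>Dyadic shells \<open>2 ^ m \<le> bracket z < 2 ^ (m + 1)\<close> contain at most \<open>5 ^ d * 2 ^ (m d)\<close> points, so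
  they contribute a geometric series of ratio \<open>2 powr - t\<close>. The sum \<open>1 / (1 - 2 powr - t)\<close> of the series
  is what produces the factor \<open>1 / t\<close>, and it is important that it appears to the first power in every
  dimension.\<close>

lemma lattice_sum_le:
  assumes t: "0 < t" "t \<le> 1" and Z: "finite (Z :: (int ^ 'd::finite) set)"
  shows "(\<Sum>z\<in>Z. bracket z powr (- real CARD('d) - t)) \<le> 3 * 5 ^ CARD('d) / t"
proof -
  let ?d = "CARD('d)"
  define q where "q = (2::real) powr - t"
  have q: "0 < q" "q < 1" using t by (auto simp: q_def powr_less_one)
  define k where "k z = nat \<lfloor>log 2 (bracket z)\<rfloor>" for z :: "int ^ 'd"
  have k: "2 ^ k z \<le> bracket z \<and> bracket z < 2 ^ Suc (k z)" for z
  proof -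
    have b: "1 \<le> bracket z" by (rule bracket_ge_1)
    then have l: "0 \<le> log 2 (bracket z)" by (simp add: zero_le_log_cancel_iff)
    have 1: "real (k z) \<le> log 2 (bracket z)" "log 2 (bracket z) < real (Suc (k z))"
      using l by (auto simp: k_def) linarith+
    have "2 powr real (k z) \<le> bracket z" using 1(1) b by (subst (asm) le_log_iff) auto
    moreover have "bracket z < 2 powr real (Suc (k z))" using 1(2) b by (subst (asm) log_less_iff) auto
    ultimately show ?thesis unfolding powr_realpow'[of "2::real"] by (simp add: powr_realpow del: of_nat_Suc power_Suc)
  qed
  have shell: "(\<Sum>z\<in>{z \<in> Z. k z = m}. bracket z powr (- real ?d - t)) \<le> 5 ^ ?d * q ^ m" for m
  proof -
    have "bracket z powr (- real ?d - t) \<le> (2 ^ m) powr (- real ?d - t)" if "k z = m" for z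
      by (rule powr_mono2') (use k[of z] t that in auto)
    then have "(\<Sum>z\<in>{z \<in> Z. k z = m}. bracket z powr (- real ?d - t))
        \<le> real (card {z \<in> Z. k z = m}) * (2 ^ m) powr (- real ?d - t)"
      by (intro sum_bounded_above) auto
    also have "\<dots> \<le> 5 ^ ?d * (2 ^ m) ^ ?d * (2 ^ m) powr (- real ?d - t)"
    proof (rule mult_right_mono)
      have "{z \<in> Z. k z = m} \<subseteq> {z. \<forall>i. \<bar>z $ i\<bar> \<le> int (2 * 2 ^ m)}"
      proof (clarify)
        fix z i assume "m = k z"
        then have "real_of_int \<bar>z $ i\<bar> < real_of_int (int (2 * 2 ^ k z))"
          using k[of z] abs_component_le_bracket[of z i] by auto
        then show "\<bar>z $ i\<bar> \<le> int (2 * 2 ^ k z)" by linarith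
      qed
      then have "card {z \<in> Z. k z = m} \<le> (2 * (2 * 2 ^ m) + 1) ^ ?d"
        using card_mono[OF card_lattice_cube(1)] card_lattice_cube(2) order_trans by blast
      also have "\<dots> \<le> (5 * 2 ^ m) ^ ?d" by (intro power_mono) auto
      finally have "real (card {z \<in> Z. k z = m}) \<le> real ((5 * 2 ^ m) ^ ?d)" by (rule of_nat_mono)
      then show "real (card {z \<in> Z. k z = m}) \<le> 5 ^ ?d * (2 ^ m) ^ ?d" by (simp add: power_mult_distrib)
    qed simp
    also have "\<dots> = 5 ^ ?d * q ^ m"
    proof -
      have "(2 ^ m :: real) powr (- real ?d - t) = (2 ^ m) powr (- real ?d) * (2 ^ m) powr - t"
        by (simp add: powr_add [symmetric])
      also have "(2 ^ m :: real) powr (- real ?d) = inverse ((2 ^ m) ^ ?d)"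
        by (simp add: powr_minus powr_realpow)
      also have "(2 ^ m :: real) powr - t = q ^ m"
        by (simp add: q_def powr_realpow [symmetric] powr_powr mult.commute)
      finally show ?thesis by simp
    qed
    finally show ?thesis .
  qed
  define N where "N = Max (insert 0 (k ` Z))"
  have "(\<Sum>z\<in>Z. bracket z powr (- real ?d - t))
      = (\<Sum>m\<le>N. \<Sum>z\<in>{z \<in> Z. k z = m}. bracket z powr (- real ?d - t))"
    by (rule sum.group[symmetric]) (use Z in \<open>auto simp: N_def\<close>)
  also have "\<dots> \<le> (\<Sum>m\<le>N. 5 ^ ?d * q ^ m)" by (intro sum_mono shell)
  also have "\<dots> = 5 ^ ?d * (\<Sum>m\<le>N. q ^ m)" by (simp add: sum_distrib_left)
  also have "(\<Sum>m\<le>N. q ^ m) \<le> (\<Sum>m. q ^ m)"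
    by (rule sum_le_suminf) (use q in \<open>auto intro: summable_geometric\<close>)
  also have "(\<Sum>m. q ^ m) = 1 / (1 - q)" using q by (intro suminf_geometric) auto
  also have "\<dots> \<le> 3 / t"
  proof -
    \<comment> \<open>The bound \<open>1 - 2 powr - t \<ge> t / 3\<close> holds up to \<open>t = 1\<close>.\<close>
    have "1 + t * ln 2 \<le> exp (t * ln 2)" by (rule exp_ge_add_one_self)
    moreover have "t * (2/3) \<le> t * ln 2"
      using t ln2_ge_two_thirds by (intro mult_left_mono) auto
    ultimately have "1 + t * (2/3) \<le> exp (t * ln 2)" by linarith
    then have "1 + t * (2/3) \<le> 2 powr t" by (simp add: powr_def)
    then have "q \<le> 1 / (1 + t * (2/3))"
      using t by (auto simp: q_def powr_minus inverse_eq_divide intro!: divide_left_mono mult_pos_pos)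
    also have "\<dots> \<le> 1 - t / 3"
    proof -
      have "t * t \<le> t * 1" using t by (intro mult_left_mono) auto
      then have "1 \<le> (1 - t / 3) * (1 + t * (2/3))" using t by (simp add: algebra_simps)
      then show ?thesis using t by (simp add: pos_divide_le_eq)
    qed
    finally show ?thesis using t q by (simp add: field_simps)
  qed
  finally show ?thesis by (simp add: mult_left_mono mult.commute)
qed

section \<open>Iterated differences\<close>

text \<open>The sign is opposite to that of the usual forward difference: a translation by \<open>v\<close> will reverse
  the sign of the exponential, so that \<open>fdiff v\<close> acts on the Fourier integral as multiplication by \<open>2\<close>.\<close>

definition fdiff :: "'a::ab_group_add \<Rightarrow> ('a \<Rightarrow> 'b::ab_group_add) \<Rightarrow> 'a \<Rightarrow> 'b" where
  "fdiff v f = (\<lambda>p. f p - f (p + v))"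

lemma fdiff_power_Suc:
  "(fdiff v ^^ Suc s) f = (\<lambda>p. (fdiff v ^^ s) f p - (fdiff v ^^ s) f (p + v))"
  unfolding funpow.simps o_def by (subst fdiff_def) (rule refl)

lemma fdiff_power_has_vector_derivative:
  fixes f :: "real \<Rightarrow> complex"
  assumes "\<And>j. j \<le> s \<Longrightarrow> (f has_vector_derivative f' (t + real j * h)) (at (t + real j * h))"
  shows "((fdiff h ^^ s) f has_vector_derivative (fdiff h ^^ s) f' t) (at t)"
  using assms
proof (induction s arbitrary: t)
  case 0
  then show ?case using 0[of 0] by simp
next
  case (Suc s)
  have 1: "((fdiff h ^^ s) f has_vector_derivative (fdiff h ^^ s) f' t) (at t)"
    by (rule Suc.IH) (use Suc.prems in force)
  have 2: "((fdiff h ^^ s) f has_vector_derivative (fdiff h ^^ s) f' (t + h)) (at (t + h))"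
  proof (rule Suc.IH)
    fix j assume "j \<le> s"
    then show "(f has_vector_derivative f' (t + h + real j * h)) (at (t + h + real j * h))"
      using Suc.prems[of "Suc j"] by (simp add: algebra_simps)
  qed
  have "((\<lambda>u. u + h) has_vector_derivative 1) (at t)"
    by (auto intro!: derivative_eq_intros)
  from vector_diff_chain_at[OF this 2]
  have "((\<lambda>u. (fdiff h ^^ s) f (u + h)) has_vector_derivative (fdiff h ^^ s) f' (t + h)) (at t)"
    by (simp add: o_def)
  from has_vector_derivative_diff[OF 1 this] show ?case by (simp only: fdiff_power_Suc)
qed

text \<open>The sequence \<open>g\<close> consists of a function and its derivatives. Each difference costs one mean value
  inequality, which replaces \<open>g r\<close> by \<open>g (Suc r)\<close> and gains a factor \<open>h\<close>; the points at which the
  derivative is evaluated stay in the interval of length \<open>s * h\<close>.\<close>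

lemma norm_fdiff_power_le:
  fixes g :: "nat \<Rightarrow> real \<Rightarrow> complex"
  assumes h: "0 < h"
    and der: "\<And>r t. a \<le> t \<Longrightarrow> t \<le> a + real s * h \<Longrightarrow> (g r has_vector_derivative g (Suc r) t) (at t)"
    and B: "\<And>t. a \<le> t \<Longrightarrow> t \<le> a + real s * h \<Longrightarrow> norm (g (r + s) t) \<le> B"
  shows "norm ((fdiff h ^^ s) (g r) a) \<le> h ^ s * B"
  using der B
proof (induction s arbitrary: r a)
  case 0
  then show ?case by simp
next
  case (Suc s)
  let ?\<Phi> = "(fdiff h ^^ s) (g r)" and ?\<Phi>' = "(fdiff h ^^ s) (g (Suc r))"
  have range: "a \<le> t + real j * h \<and> t + real j * h \<le> a + real (Suc s) * h"
    if "a \<le> t" "t \<le> a + h" "j \<le> s" for t j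
  proof -
    have "real j * h \<le> real s * h" using that h by (intro mult_right_mono) auto
    moreover have "0 \<le> real j * h" using h by simp
    moreover have "real (Suc s) * h = real s * h + h" by (simp add: algebra_simps)
    ultimately show ?thesis using that(1,2) by linarith
  qed
  have der: "(?\<Phi> has_vector_derivative ?\<Phi>' t) (at t)" if "a \<le> t" "t \<le> a + h" for t
    by (rule fdiff_power_has_vector_derivative) (use range[OF that] Suc.prems(1) in blast)
  have bd: "norm (?\<Phi>' t) \<le> h ^ s * B" if t: "a \<le> t" "t \<le> a + h" for t
  proof (rule Suc.IH)
    fix u assume "t \<le> u" "u \<le> t + real s * h"
    then have u: "a \<le> u" "u \<le> a + real (Suc s) * h" using t by (simp_all add: algebra_simps)
    show "(g r has_vector_derivative g (Suc r) u) (at u)" for r using Suc.prems(1)[OF u] .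
    show "norm (g (Suc r + s) u) \<le> B" using Suc.prems(2)[OF u] by simp
  qed
  have "continuous_on {a..a + h} ?\<Phi>"
    by (intro continuous_at_imp_continuous_on ballI has_vector_derivative_continuous[OF der]) auto
  then obtain t where t: "t \<in> {a<..<a + h}"
      "norm (?\<Phi> (a + h) - ?\<Phi> a) \<le> norm ((a + h - a) *\<^sub>R ?\<Phi>' t)"
    using mvt_general[of a "a + h" ?\<Phi> "\<lambda>t u. u *\<^sub>R ?\<Phi>' t"] h der
    unfolding has_vector_derivative_def by auto
  have "norm (?\<Phi> (a + h) - ?\<Phi> a) \<le> h * (h ^ s * B)"
    using t h bd[of t] by (simp add: order_trans[OF _ mult_left_mono])
  then show ?case by (simp add: fdiff_power_Suc norm_minus_commute del: funpow.simps)
qed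

lemma fdiff_power_along_line:
  fixes f :: "'a::real_vector \<Rightarrow> 'b::ab_group_add"
  shows "(fdiff (h *\<^sub>R e) ^^ s) f (p + t *\<^sub>R e) = (fdiff h ^^ s) (\<lambda>t. f (p + t *\<^sub>R e)) t"
proof (induction s arbitrary: t)
  case 0
  then show ?case by simp
next
  case (Suc s)
  have "p + t *\<^sub>R e + h *\<^sub>R e = p + (t + h) *\<^sub>R e" by (simp add: algebra_simps)
  then show ?case using Suc[of t] Suc[of "t + h"] by (simp only: fdiff_power_Suc)
qed

section \<open>Multipliers away from the dual lattice\<close>

lemma partial_deriv_along_axis:
  assumes "f differentiable (at (p + t *\<^sub>R axis i 1))"
  shows "((\<lambda>t. f (p + t *\<^sub>R axis i 1)) has_vector_derivative
            partial_deriv i f (p + t *\<^sub>R axis i 1)) (at t)"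
proof -
  let ?e = "axis i 1 :: real ^ 'a"
  obtain f' where f': "(f has_derivative f') (at (p + t *\<^sub>R ?e))"
    using assms by (auto simp: differentiable_def)
  have lin: "f' (u *\<^sub>R ?e) = u *\<^sub>R f' ?e" for u
    using has_derivative_bounded_linear[OF f'] by (simp add: bounded_linear.linear linear_cmul)
  have gen: "((\<lambda>u. f (q + u *\<^sub>R ?e)) has_vector_derivative f' ?e) (at u)"
    if "q + u *\<^sub>R ?e = p + t *\<^sub>R ?e" for q u
  proof -
    have "((\<lambda>u. q + u *\<^sub>R ?e) has_derivative (\<lambda>u. u *\<^sub>R ?e)) (at u)"
      by (auto intro!: derivative_eq_intros)
    from diff_chain_at[OF this, of f f'] f' that
    show ?thesis by (simp add: has_vector_derivative_def o_def lin)
  qed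
  have "partial_deriv i f (p + t *\<^sub>R ?e) = f' ?e"
    unfolding partial_deriv_def by (rule vector_derivative_at) (rule gen, simp)
  then show ?thesis using gen[of p t] by simp
qed

lemma partial_derivs_periodic:
  assumes "\<And>\<theta>. m (\<theta> + c) = m \<theta>"
  shows "partial_derivs l m (\<theta> + c) = partial_derivs l m \<theta>"
proof (induction l arbitrary: \<theta>)
  case Nil
  then show ?case by (simp add: assms)
next
  case (Cons i l)
  have "partial_derivs l m (\<theta> + c + t *\<^sub>R axis i 1) = partial_derivs l m (\<theta> + t *\<^sub>R axis i 1)" for t
    using Cons.IH[of "\<theta> + t *\<^sub>R axis i 1"] by (simp add: ac_simps)
  then show ?case by (simp add: partial_deriv_def)
qed

lemma periodic_of_int:
  fixes f :: "'a::real_vector \<Rightarrow> 'b"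
  assumes per: "\<And>p. f (p + c) = f p"
  shows "f (p + of_int k *\<^sub>R c) = f p"
proof -
  have nat: "f (p + of_nat n *\<^sub>R c) = f p" for n p
  proof (induction n)
    case (Suc n)
    have eq: "p + of_nat (Suc n) *\<^sub>R c = (p + of_nat n *\<^sub>R c) + c" by (simp add: algebra_simps)
    show ?case unfolding eq per by (rule Suc)
  qed simp
  show ?thesis
  proof (cases "0 \<le> k")
    case True
    then show ?thesis using nat[of p "nat k"] by simp
  next
    case False
    then have "of_nat (nat (- k)) = - (of_int k :: real)" by simp
    then have eq: "p + of_int k *\<^sub>R c + of_nat (nat (- k)) *\<^sub>R c = p" by simp
    show ?thesis using nat[of "p + of_int k *\<^sub>R c" "nat (- k)"] unfolding eq by (rule sym)
  qed
qed

lemma mem_torus: "\<theta> \<in> torus \<longleftrightarrow> (\<forall>j. \<bar>\<theta> $ j\<bar> \<le> pi)"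
  by (auto simp: torus_def mem_box_cart abs_le_iff) (metis minus_le_iff)+

lemma torus_int_dual_lattice:
  assumes "\<theta> \<in> torus" "\<theta> \<in> dual_lattice" shows "\<theta> = 0"
proof -
  have "\<theta> $ j = 0" for j
  proof -
    obtain k :: int where k: "\<theta> $ j = 2 * pi * of_int k" using assms(2) by (auto simp: dual_lattice_def)
    have "\<bar>\<theta> $ j\<bar> \<le> pi" using assms(1) by (simp add: mem_torus)
    then have "pi * (2 * \<bar>of_int k\<bar>) \<le> pi * 1" by (simp add: k abs_mult)
    then have "2 * \<bar>of_int k\<bar> \<le> (1 :: real)" by (rule mult_left_le_imp_le) simp
    then have "k = 0" by linarith
    then show ?thesis using k by simp
  qed
  then show ?thesis by (simp add: vec_eq_iff)
qed

lemma reduce_angle: "\<exists>k::int. \<bar>t - 2 * pi * of_int k\<bar> \<le> pi"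
proof -
  define k where "k = round (t / (2 * pi))"
  have "\<bar>of_int k - t / (2 * pi)\<bar> \<le> 1/2" unfolding k_def by (rule of_int_round_abs_le)
  then have "(2 * pi) * \<bar>of_int k - t / (2 * pi)\<bar> \<le> (2 * pi) * (1/2)" by (intro mult_left_mono) auto
  also have "(2 * pi) * \<bar>of_int k - t / (2 * pi)\<bar> = \<bar>(2 * pi) * (of_int k - t / (2 * pi))\<bar>"
    by (simp add: abs_mult)
  also have "(2 * pi) * (of_int k - t / (2 * pi)) = - (t - 2 * pi * of_int k)" by (simp add: algebra_simps)
  finally show ?thesis by (intro exI[of _ k]) simp
qed

lemma norm_translate_torus_ge:
  assumes "\<theta> \<in> torus"
  shows "norm \<theta> \<le> norm (\<theta> - of_int k *\<^sub>R ((2 * pi) *\<^sub>R axis i 1))"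
proof (rule norm_le_componentwise_cart)
  fix j
  have t: "\<bar>\<theta> $ j\<bar> \<le> pi" using assms by (simp add: mem_torus)
  show "norm (\<theta> $ j) \<le> norm ((\<theta> - of_int k *\<^sub>R ((2 * pi) *\<^sub>R axis i 1)) $ j)"
  proof (cases "j = i \<and> k \<noteq> 0")
    case True
    then have "1 \<le> \<bar>of_int k :: real\<bar>" by linarith
    then have "2 * pi * 1 \<le> 2 * pi * \<bar>of_int k\<bar>" by (intro mult_left_mono) auto
    also have "\<dots> = \<bar>of_int k * (2 * pi)\<bar>" by (simp add: abs_mult)
    finally show ?thesis using True t by simp
  qed (auto simp: axis_def)
qed

text \<open>The derivative bounds of a multiplier are given only on the torus, but differences evaluate it at
  translates that may leave the torus. A translate is moved back by a multiple of the period, and the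
  distance to 0 does not shrink by more than half as 0 is the point of the dual lattice nearest to
  a point of the torus.\<close>

lemma partial_derivs_bound_near:
  fixes m :: "real ^ 'd::finite \<Rightarrow> complex"
  assumes m: "singular_multiplier C m" and \<theta>: "\<theta> \<in> torus" "\<theta> \<noteq> 0" and t: "2 * \<bar>t\<bar> \<le> norm \<theta>"
  shows "\<theta> + t *\<^sub>R axis i 1 \<notin> dual_lattice"
    and "norm (partial_derivs l m (\<theta> + t *\<^sub>R axis i 1))
       \<le> C (count_list l) * (norm \<theta> / 2) powr (- real (length l))"
proof -
  let ?e = "axis i 1 :: real ^ 'd"
  let ?p = "\<theta> + t *\<^sub>R ?e"
  obtain k :: int where k: "\<bar>\<theta> $ i + t - 2 * pi * of_int k\<bar> \<le> pi" using reduce_angle by blast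
  define q where "q = ?p + of_int (- k) *\<^sub>R ((2 * pi) *\<^sub>R ?e)"
  have qT: "q \<in> torus"
    unfolding mem_torus
  proof
    fix j show "\<bar>q $ j\<bar> \<le> pi"
      using k \<theta>(1) by (cases "j = i") (auto simp: q_def mem_torus axis_def algebra_simps)
  qed
  have "norm \<theta> \<le> norm (\<theta> - of_int k *\<^sub>R ((2 * pi) *\<^sub>R ?e))" by (rule norm_translate_torus_ge[OF \<theta>(1)])
  also have "\<theta> - of_int k *\<^sub>R ((2 * pi) *\<^sub>R ?e) = q - t *\<^sub>R ?e" by (simp add: q_def)
  also have "norm (q - t *\<^sub>R ?e) \<le> norm q + \<bar>t\<bar>"
    using norm_triangle_ineq4[of q "t *\<^sub>R ?e"] by simp
  finally have nq: "norm \<theta> / 2 \<le> norm q" using t by simp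
  have q0: "q \<noteq> 0" using nq \<theta>(2) by auto
  show "?p \<notin> dual_lattice"
  proof
    assume p: "?p \<in> dual_lattice"
    have "q \<in> dual_lattice"
      unfolding dual_lattice_def mem_Collect_eq
    proof
      fix j
      obtain k' :: int where k': "?p $ j = 2 * pi * of_int k'"
        using p unfolding dual_lattice_def by blast
      have "q $ j = 2 * pi * of_int (if j = i then k' - k else k')"
        using k' by (auto simp: q_def axis_def algebra_simps)
      then show "\<exists>k. q $ j = 2 * pi * of_int k" by blast
    qed
    then show False using torus_int_dual_lattice[OF qT] q0 by simp
  qed
  have per: "m (\<theta> + (2 * pi) *\<^sub>R ?e) = m \<theta>" for \<theta> using m by (simp add: singular_multiplier_def)
  have "partial_derivs l m q = partial_derivs l m ?p"
    unfolding q_def by (rule periodic_of_int) (rule partial_derivs_periodic, rule per)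
  then have b: "norm (partial_derivs l m ?p) \<le> C (count_list l) * norm q powr (- real (length l))"
    using m qT q0 unfolding singular_multiplier_def by (metis DiffI singletonD)
  also have "\<dots> \<le> C (count_list l) * (norm \<theta> / 2) powr (- real (length l))"
  proof (rule mult_left_mono)
    show "norm q powr (- real (length l)) \<le> (norm \<theta> / 2) powr (- real (length l))"
      by (rule powr_mono2') (use nq \<theta>(2) in auto)
    have "0 \<le> C (count_list l) * norm q powr (- real (length l))" using b norm_ge_zero order_trans by blast
    moreover have "0 < norm q powr (- real (length l))" using q0 by simp
    ultimately show "0 \<le> C (count_list l)" by (simp add: zero_le_mult_iff)
  qed
  finally show "norm (partial_derivs l m ?p) \<le> C (count_list l) * (norm \<theta> / 2) powr (- real (length l))" .
qed

lemma fdiff_multiplier_bound_far: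
  fixes m :: "real ^ 'd::finite \<Rightarrow> complex"
  assumes m: "singular_multiplier C m" and \<theta>: "\<theta> \<in> torus" "\<theta> \<noteq> 0"
    and h: "0 < h" "2 * (real s * h) \<le> norm \<theta>"
  shows "norm ((fdiff (h *\<^sub>R axis i 1) ^^ s) m \<theta>)
       \<le> C (count_list (replicate s i)) * (2 * h / norm \<theta>) ^ s"
proof -
  let ?e = "axis i 1 :: real ^ 'd"
  define g where "g r t = partial_derivs (replicate r i) m (\<theta> + t *\<^sub>R ?e)" for r t
  have near: "2 * \<bar>t\<bar> \<le> norm \<theta>" if "0 \<le> t" "t \<le> 0 + real s * h" for t
    using that h by simp
  have "norm ((fdiff h ^^ s) (g 0) 0)
      \<le> h ^ s * (C (count_list (replicate s i)) * (norm \<theta> / 2) powr (- real s))"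
  proof (rule norm_fdiff_power_le[OF h(1)])
    fix r t assume t: "0 \<le> t" "t \<le> 0 + real s * h"
    have "partial_derivs (replicate r i) m differentiable (at (\<theta> + t *\<^sub>R ?e))"
      using m partial_derivs_bound_near(1)[OF m \<theta> near[OF t]] by (simp add: singular_multiplier_def)
    from partial_deriv_along_axis[OF this]
    show "(g r has_vector_derivative g (Suc r) t) (at t)"
      unfolding g_def by simp
  next
    fix t assume t: "0 \<le> t" "t \<le> 0 + real s * h"
    show "norm (g (0 + s) t) \<le> C (count_list (replicate s i)) * (norm \<theta> / 2) powr (- real s)"
      using partial_derivs_bound_near(2)[OF m \<theta> near[OF t], of "replicate s i"] by (simp add: g_def)
  qed
  also have "(fdiff h ^^ s) (g 0) 0 = (fdiff (h *\<^sub>R ?e) ^^ s) m \<theta>"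
    using fdiff_power_along_line[of s h ?e m \<theta> 0] by (simp add: g_def[abs_def])
  also have "h ^ s * (C (count_list (replicate s i)) * (norm \<theta> / 2) powr (- real s))
      = C (count_list (replicate s i)) * (2 * h / norm \<theta>) ^ s"
    using \<theta>(2) by (simp add: powr_minus powr_realpow field_simps power_mult_distrib power_divide)
  finally show ?thesis .
qed

section \<open>Integrals over the torus\<close>

text \<open>All translations will be in the direction of one coordinate, so bounds for a multiplier are needed
  on the union of the translates of the torus in this direction only.\<close>

definition strip :: "'d \<Rightarrow> (real ^ 'd::finite) set" where
  "strip i = {\<theta>. \<forall>j. j \<noteq> i \<longrightarrow> \<bar>\<theta> $ j\<bar> \<le> pi}"

definition slab :: "'d \<Rightarrow> real \<Rightarrow> real \<Rightarrow> (real ^ 'd::finite) set" where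
  "slab i a b = {\<theta> \<in> strip i. a \<le> \<theta> $ i \<and> \<theta> $ i < b}"

lemma slab_subset_strip: "slab i a b \<subseteq> strip i"
  by (auto simp: slab_def)

lemma slab_measurable [measurable]: "slab i a b \<in> sets borel"
proof -
  have [measurable]: "(\<lambda>\<theta> :: real ^ 'a. \<theta> $ j) \<in> borel_measurable borel" for j
    by (intro borel_measurable_continuous_onI continuous_intros)
  have "slab i a b = (\<Inter>j. {\<theta>. j \<noteq> i \<longrightarrow> \<bar>\<theta> $ j\<bar> \<le> pi}) \<inter> {\<theta>. a \<le> \<theta> $ i \<and> \<theta> $ i < b}"
    by (auto simp: slab_def strip_def)
  also have "\<dots> \<in> sets borel" by measurable
  finally show ?thesis .
qed

lemma slab_finite_measure: "emeasure lborel (slab i a b :: (real ^ 'd::finite) set) < \<infinity>"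
proof -
  have "slab i a b \<subseteq> cbox (\<chi> j. - \<bar>a\<bar> - \<bar>b\<bar> - pi) (\<chi> j. \<bar>a\<bar> + \<bar>b\<bar> + pi :: real ^ 'd)"
  proof
    fix \<theta> assume t: "\<theta> \<in> slab i a b"
    have "- \<bar>a\<bar> - \<bar>b\<bar> - pi \<le> \<theta> $ j \<and> \<theta> $ j \<le> \<bar>a\<bar> + \<bar>b\<bar> + pi" for j
    proof (cases "j = i")
      case True
      then have "a \<le> \<theta> $ j" "\<theta> $ j \<le> b" using t by (auto simp: slab_def)
      then show ?thesis using pi_gt_zero by linarith
    next
      case False
      then have "\<bar>\<theta> $ j\<bar> \<le> pi" using t by (auto simp: slab_def strip_def)
      then show ?thesis by linarith
    qed
    then show "\<theta> \<in> cbox (\<chi> j. - \<bar>a\<bar> - \<bar>b\<bar> - pi) (\<chi> j. \<bar>a\<bar> + \<bar>b\<bar> + pi)"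
      by (simp add: mem_box_cart)
  qed
  then have "emeasure lborel (slab i a b)
      \<le> emeasure lborel (cbox (\<chi> j. - \<bar>a\<bar> - \<bar>b\<bar> - pi) (\<chi> j. \<bar>a\<bar> + \<bar>b\<bar> + pi :: real ^ 'd))"
    by (intro emeasure_mono) auto
  also have "\<dots> < \<infinity>" by (rule emeasure_lborel_cbox_finite)
  finally show ?thesis .
qed

lemma integral_slab_translate:
  fixes F :: "real ^ 'd::finite \<Rightarrow> complex"
  assumes [measurable]: "F \<in> borel_measurable borel"
  shows "(LINT \<theta>:slab i a b|lborel. F (\<theta> + c *\<^sub>R axis i 1)) = (LINT \<theta>:slab i (a + c) (b + c)|lborel. F \<theta>)"
proof -
  let ?v = "c *\<^sub>R axis i 1 :: real ^ 'd"
  let ?g = "\<lambda>\<theta>. indicator (slab i (a + c) (b + c)) \<theta> *\<^sub>R F \<theta>"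
  have mem: "\<theta> + ?v \<in> slab i (a + c) (b + c) \<longleftrightarrow> \<theta> \<in> slab i a b" for \<theta>
    by (auto simp: slab_def strip_def axis_def)
  have "(LINT \<theta>:slab i (a + c) (b + c)|lborel. F \<theta>) = integral\<^sup>L (distr lborel borel ((+) ?v)) ?g"
    by (simp only: lborel_distr_plus set_lebesgue_integral_def)
  also have "\<dots> = (LINT \<theta>|lborel. ?g (?v + \<theta>))"
    by (rule integral_distr) measurable
  also have "\<dots> = (LINT \<theta>:slab i a b|lborel. F (\<theta> + ?v))"
    unfolding set_lebesgue_integral_def
    by (intro Bochner_Integration.integral_cong) (simp_all add: indicator_def mem add.commute[of ?v])
  finally show ?thesis by simp
qed

lemma hyperplane_null: "{\<theta> :: real ^ 'd::finite. \<theta> $ i = c} \<in> null_sets lborel"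
proof -
  have "closed {\<theta> :: real ^ 'd. \<theta> $ i = c}" by (intro closed_Collect_eq continuous_intros)
  moreover have "{\<theta> :: real ^ 'd. \<theta> $ i = c} \<in> null_sets lebesgue"
    using negligible_standard_hyperplane[of "axis i 1 :: real ^ 'd" c]
    by (simp add: negligible_iff_null_sets inner_axis axis_in_Basis_iff)
  ultimately show ?thesis by (simp add: null_sets_completion_iff borel_closed)
qed

lemma integral_torus_slab:
  fixes F :: "real ^ 'd::finite \<Rightarrow> complex"
  assumes [measurable]: "F \<in> borel_measurable borel"
  shows "(LINT \<theta>:torus|lborel. F \<theta>) = (LINT \<theta>:slab i (- pi) pi|lborel. F \<theta>)"
proof -
  have [measurable]: "torus \<in> sets (borel :: (real ^ 'd) measure)" by (simp add: torus_def)
  have "AE \<theta> :: real ^ 'd in lborel. \<theta> $ i \<noteq> pi"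
    using AE_not_in[OF hyperplane_null[of i pi]] by simp
  then have "AE \<theta> in lborel. indicator torus \<theta> *\<^sub>R F \<theta> = indicator (slab i (- pi) pi) \<theta> *\<^sub>R F \<theta>"
  proof eventually_elim
    fix \<theta> :: "real ^ 'd" assume "\<theta> $ i \<noteq> pi"
    then have "\<theta> \<in> torus \<longleftrightarrow> \<theta> \<in> slab i (- pi) pi"
      by (auto simp: mem_torus slab_def strip_def abs_le_iff less_le) (metis minus_le_iff)+
    then show "indicator torus \<theta> *\<^sub>R F \<theta> = indicator (slab i (- pi) pi) \<theta> *\<^sub>R F \<theta>"
      by (simp add: indicator_def)
  qed
  then show ?thesis
    unfolding set_lebesgue_integral_def by (intro integral_cong_AE) auto
qed

text \<open>The translated cube sticks out by a slab of width \<open>h\<close>, and periodicity moves this slab back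
  to the opposite side. Half-open slabs make the pieces disjoint.\<close>

lemma integral_torus_translate:
  fixes F :: "real ^ 'd::finite \<Rightarrow> complex"
  assumes F [measurable]: "F \<in> borel_measurable borel"
    and per: "\<And>\<theta>. F (\<theta> + (2 * pi) *\<^sub>R axis i 1) = F \<theta>"
    and bd: "countable N" "\<And>\<theta>. \<theta> \<in> strip i \<Longrightarrow> \<theta> \<notin> N \<Longrightarrow> norm (F \<theta>) \<le> M"
    and h: "0 \<le> h" "h \<le> 2 * pi"
  shows "(LINT \<theta>:torus|lborel. F (\<theta> + h *\<^sub>R axis i 1)) = (LINT \<theta>:torus|lborel. F \<theta>)"
proof -
  let ?J = "\<lambda>a b. LINT \<theta>:slab i a b|lborel. F \<theta>"
  have AE: "AE \<theta> in lborel. \<theta> \<notin> N"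
    by (rule AE_not_in) (rule countable_imp_null_set_lborel[OF bd(1)])
  have int: "set_integrable lborel (slab i a b) F" for a b
    unfolding set_integrable_def
    by (rule integrableI_bounded_set_indicator[where B = M])
       (use slab_finite_measure AE in \<open>auto intro!: bd(2) dest: slab_subset_strip[THEN subsetD] elim!: eventually_mono\<close>)
  have split: "?J a c = ?J a b + ?J b c" if "a \<le> b" "b \<le> c" for a b c
  proof -
    have "slab i a c = slab i a b \<union> slab i b c" using that by (auto simp: slab_def)
    moreover have "slab i a b \<inter> slab i b c = {}" by (auto simp: slab_def)
    ultimately show ?thesis by (simp add: set_integral_Un int)
  qed
  have "(LINT \<theta>:torus|lborel. F (\<theta> + h *\<^sub>R axis i 1))
      = (LINT \<theta>:slab i (- pi) pi|lborel. F (\<theta> + h *\<^sub>R axis i 1))"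
    by (rule integral_torus_slab) measurable
  also have "\<dots> = ?J (- pi + h) (pi + h)" by (rule integral_slab_translate) measurable
  also have "\<dots> = ?J (- pi + h) pi + ?J pi (pi + h)" by (rule split) (use h in auto)
  also have "?J pi (pi + h) = ?J (- pi) (- pi + h)"
    using integral_slab_translate[OF F, of i "- pi" "- pi + h" "2 * pi"] by (simp add: per)
  also have "?J (- pi + h) pi + ?J (- pi) (- pi + h) = ?J (- pi) pi"
    using split[of "- pi" "- pi + h" pi] h by simp
  also have "\<dots> = (LINT \<theta>:torus|lborel. F \<theta>)" by (rule integral_torus_slab[symmetric]) measurable
  finally show ?thesis .
qed

text \<open>A countable exceptional set is allowed because a multiplier is arbitrary on the dual lattice. Countability
  passes to translates, hence to iterated differences.\<close>

definition strip_bounded :: "'d \<Rightarrow> real \<Rightarrow> (real ^ 'd::finite \<Rightarrow> complex) \<Rightarrow> bool" where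
  "strip_bounded i M f \<longleftrightarrow> f \<in> borel_measurable borel \<and>
     (\<forall>\<theta>. f (\<theta> + (2 * pi) *\<^sub>R axis i 1) = f \<theta>) \<and>
     (\<exists>N. countable N \<and> (\<forall>\<theta>\<in>strip i - N. norm (f \<theta>) \<le> M))"

lemma strip_bounded_fdiff:
  assumes f: "strip_bounded i M f"
  shows "strip_bounded i (2 * M) (fdiff (h *\<^sub>R axis i 1) f)"
proof -
  let ?v = "h *\<^sub>R axis i 1 :: real ^ 'a"
  obtain N where N: "countable N" "\<And>\<theta>. \<theta> \<in> strip i - N \<Longrightarrow> norm (f \<theta>) \<le> M"
    and [measurable]: "f \<in> borel_measurable borel"
    and per: "\<And>\<theta>. f (\<theta> + (2 * pi) *\<^sub>R axis i 1) = f \<theta>"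
    using f by (auto simp: strip_bounded_def)
  have "fdiff ?v f \<in> borel_measurable borel" unfolding fdiff_def by measurable
  moreover have "fdiff ?v f (\<theta> + (2 * pi) *\<^sub>R axis i 1) = fdiff ?v f \<theta>" for \<theta>
    using per[of \<theta>] per[of "\<theta> + ?v"] by (simp add: fdiff_def ac_simps)
  moreover have "countable (N \<union> (\<lambda>\<theta>. \<theta> - ?v) ` N)" using N(1) by auto
  moreover have "norm (fdiff ?v f \<theta>) \<le> 2 * M"
    if "\<theta> \<in> strip i - (N \<union> (\<lambda>\<theta>. \<theta> - ?v) ` N)" for \<theta>
  proof -
    have "\<theta> + ?v \<notin> N" using that by (auto simp: image_iff dest: bspec[of N _ "\<theta> + ?v"])
    moreover have "\<theta> + ?v \<in> strip i" using that by (auto simp: strip_def axis_def)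
    ultimately have "norm (f \<theta>) \<le> M" "norm (f (\<theta> + ?v)) \<le> M" using N(2) that by auto
    then show ?thesis using norm_triangle_ineq4[of "f \<theta>" "f (\<theta> + ?v)"] by (simp add: fdiff_def)
  qed
  ultimately show ?thesis unfolding strip_bounded_def by blast
qed

lemma strip_bounded_fdiff_power:
  "strip_bounded i M f \<Longrightarrow> strip_bounded i (2 ^ s * M) ((fdiff (h *\<^sub>R axis i 1) ^^ s) f)"
proof (induction s)
  case (Suc s)
  from strip_bounded_fdiff[OF Suc.IH[OF Suc.prems]] show ?case by (simp add: mult.assoc)
qed simp

lemma integrable_strip_bounded:
  assumes f: "strip_bounded i M f"
  shows "set_integrable lborel torus (\<lambda>\<theta>. f \<theta> * cis (\<theta> \<bullet> y))"
proof -
  obtain N where N: "countable N" "\<And>\<theta>. \<theta> \<in> strip i - N \<Longrightarrow> norm (f \<theta>) \<le> M"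
    and [measurable]: "f \<in> borel_measurable borel"
    using f by (auto simp: strip_bounded_def)
  have [measurable]: "(\<lambda>\<theta>. cis (\<theta> \<bullet> y)) \<in> borel_measurable borel"
    by (intro borel_measurable_continuous_onI continuous_intros)
  have AE: "AE \<theta> in lborel. \<theta> \<notin> N"
    by (rule AE_not_in) (rule countable_imp_null_set_lborel[OF N(1)])
  have tc: "torus \<subseteq> strip i" by (auto simp: mem_torus strip_def)
  show ?thesis
    unfolding set_integrable_def
  proof (rule integrableI_bounded_set_indicator[where B = M])
    show "AE \<theta> in lborel. \<theta> \<in> torus \<longrightarrow> norm (f \<theta> * cis (\<theta> \<bullet> y)) \<le> M"
      using AE by (rule eventually_mono) (use N(2) tc in \<open>auto simp: norm_mult\<close>)
    show "emeasure lborel (torus :: (real ^ 'a) set) < \<infinity>"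
      unfolding torus_def by (rule emeasure_lborel_cbox_finite)
  qed (auto simp: torus_def)
qed

text \<open>The step \<open>pi / \<bar>x $ i\<bar>\<close> is half a wave length of the exponential in direction \<open>i\<close>: the translation
  changes its sign, and otherwise leaves the integral of a periodic function alone. Iterating this
  replaces integration by parts.\<close>

lemma fourier_integral_fdiff:
  fixes x :: "int ^ 'd::finite"
  assumes f: "strip_bounded i M f" and x: "x $ i \<noteq> 0"
  defines "v \<equiv> (pi / \<bar>real_of_int (x $ i)\<bar>) *\<^sub>R axis i 1"
  shows "(LINT \<theta>:torus|lborel. fdiff v f \<theta> * cis (\<theta> \<bullet> real_vec x))
       = 2 * (LINT \<theta>:torus|lborel. f \<theta> * cis (\<theta> \<bullet> real_vec x))"
proof -
  obtain N where N: "countable N" "\<And>\<theta>. \<theta> \<in> strip i - N \<Longrightarrow> norm (f \<theta>) \<le> M"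
    and [measurable]: "f \<in> borel_measurable borel"
    and per: "\<And>\<theta>. f (\<theta> + (2 * pi) *\<^sub>R axis i 1) = f \<theta>"
    using f by (auto simp: strip_bounded_def)
  define F where "F \<theta> = f \<theta> * cis (\<theta> \<bullet> real_vec x)" for \<theta>
  have cis_meas [measurable]: "(\<lambda>\<theta>. cis (\<theta> \<bullet> real_vec x)) \<in> borel_measurable borel"
    by (intro borel_measurable_continuous_onI continuous_intros)
  have F_meas: "F \<in> borel_measurable borel" unfolding F_def by measurable
  have shift: "F (\<theta> + c *\<^sub>R axis i 1)
      = f (\<theta> + c *\<^sub>R axis i 1) * cis (\<theta> \<bullet> real_vec x) * cis (c * real_of_int (x $ i))" for \<theta> c
    by (simp add: F_def inner_add_left inner_axis' real_vec_def cis_mult)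
  have "cis (2 * pi * real_of_int (x $ i)) = 1" by simp
  then have F_per: "F (\<theta> + (2 * pi) *\<^sub>R axis i 1) = F \<theta>" for \<theta>
    unfolding shift per by (simp add: F_def)
  let ?h = "pi / \<bar>real_of_int (x $ i)\<bar>"
  have xi: "1 \<le> \<bar>real_of_int (x $ i)\<bar>" using x by linarith
  have "cis (?h * real_of_int (x $ i)) = -1"
    using x by (cases "0 < x $ i") (simp_all add: abs_if cis.code complex_eq_iff)
  then have neg: "F (\<theta> + v) = - (f (\<theta> + v) * cis (\<theta> \<bullet> real_vec x))" for \<theta>
    unfolding v_def shift by simp
  have "?h \<le> pi / 1" by (rule divide_left_mono) (use xi in auto)
  then have "?h \<le> 2 * pi" using pi_gt_zero by linarith
  moreover have "0 \<le> ?h" by simp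
  ultimately have inv: "(LINT \<theta>:torus|lborel. F (\<theta> + v)) = (LINT \<theta>:torus|lborel. F \<theta>)"
    unfolding v_def
    by (intro integral_torus_translate[OF F_meas F_per N(1), where M = M])
       (use N(2) in \<open>auto simp: F_def norm_mult\<close>)
  have intF: "set_integrable lborel torus F"
    using integrable_strip_bounded[OF f] by (simp add: F_def[abs_def])
  have eq: "fdiff v f \<theta> * cis (\<theta> \<bullet> real_vec x) = F \<theta> + F (\<theta> + v)" for \<theta>
    unfolding neg by (simp add: fdiff_def F_def algebra_simps)
  have "set_integrable lborel torus (\<lambda>\<theta>. fdiff v f \<theta> * cis (\<theta> \<bullet> real_vec x))"
    unfolding v_def by (rule integrable_strip_bounded[OF strip_bounded_fdiff[OF f]])
  from set_integral_diff(1)[OF this intF]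
  have intFv: "set_integrable lborel torus (\<lambda>\<theta>. F (\<theta> + v))"
    by (simp only: eq add_diff_cancel_left')
  have "(LINT \<theta>:torus|lborel. fdiff v f \<theta> * cis (\<theta> \<bullet> real_vec x))
      = (LINT \<theta>:torus|lborel. F \<theta>) + (LINT \<theta>:torus|lborel. F (\<theta> + v))"
    unfolding eq by (rule set_integral_add(2)[OF intF intFv])
  then have "(LINT \<theta>:torus|lborel. fdiff v f \<theta> * cis (\<theta> \<bullet> real_vec x)) = 2 * (LINT \<theta>:torus|lborel. F \<theta>)"
    by (simp only: inv mult_2)
  then show ?thesis by (simp only: F_def)
qed

lemma fourier_integral_fdiff_power:
  fixes x :: "int ^ 'd::finite"
  assumes f: "strip_bounded i M f" and x: "x $ i \<noteq> 0"
  defines "v \<equiv> (pi / \<bar>real_of_int (x $ i)\<bar>) *\<^sub>R axis i 1"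
  shows "(LINT \<theta>:torus|lborel. (fdiff v ^^ s) f \<theta> * cis (\<theta> \<bullet> real_vec x))
       = 2 ^ s * (LINT \<theta>:torus|lborel. f \<theta> * cis (\<theta> \<bullet> real_vec x))"
proof (induction s)
  case (Suc s)
  show ?case
    using fourier_integral_fdiff[OF strip_bounded_fdiff_power[OF f] x, of s] Suc
    by (simp add: v_def)
qed simp

lemma countable_dual_lattice: "countable (dual_lattice :: (real ^ 'd::finite) set)"
proof -
  have "dual_lattice \<subseteq> (\<lambda>z. \<chi> j. 2 * pi * of_int (z j)) ` (UNIV :: ('d \<Rightarrow> int) set)"
  proof
    fix \<theta> :: "real ^ 'd" assume "\<theta> \<in> dual_lattice"
    then obtain z where "\<And>j. \<theta> $ j = 2 * pi * of_int (z j :: int)"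
      unfolding dual_lattice_def by (auto dest!: choice)
    then show "\<theta> \<in> (\<lambda>z. \<chi> j. 2 * pi * of_int (z j)) ` (UNIV :: ('d \<Rightarrow> int) set)"
      by (intro image_eqI[of _ _ z]) (auto simp: vec_eq_iff)
  qed
  moreover have "countable (UNIV :: ('d \<Rightarrow> int) set)"
    using countable_PiE[of "UNIV :: 'd set" "\<lambda>_. UNIV :: int set"] by simp
  ultimately show ?thesis by (meson countable_image countable_subset)
qed

lemma strip_bounded_multiplier:
  fixes m :: "real ^ 'd::finite \<Rightarrow> complex"
  assumes m: "singular_multiplier C m"
  shows "strip_bounded i (C (count_list [])) m"
proof -
  have per: "m (\<theta> + (2 * pi) *\<^sub>R axis i 1) = m \<theta>" for \<theta> using m by (simp add: singular_multiplier_def)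
  have "continuous_on (- dual_lattice) m"
  proof (intro continuous_at_imp_continuous_on ballI)
    fix \<theta> :: "real ^ 'd" assume "\<theta> \<in> - dual_lattice"
    then have "partial_derivs [] m differentiable (at \<theta>)"
      using m unfolding singular_multiplier_def by blast
    then show "isCont m \<theta>" by (simp add: differentiable_imp_continuous_within)
  qed
  then have "m \<in> borel_measurable borel"
    by (intro borel_measurable_continuous_countable_exceptions[OF countable_dual_lattice])
  moreover have "norm (m \<theta>) \<le> C (count_list [])" if \<theta>: "\<theta> \<in> strip i - dual_lattice" for \<theta>
  proof -
    obtain k :: int where k: "\<bar>\<theta> $ i - 2 * pi * of_int k\<bar> \<le> pi" using reduce_angle by blast
    define q where "q = \<theta> + of_int (- k) *\<^sub>R ((2 * pi) *\<^sub>R axis i 1)"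
    have "q \<in> torus"
      unfolding mem_torus
    proof
      fix j show "\<bar>q $ j\<bar> \<le> pi"
        using k \<theta> by (cases "j = i") (auto simp: q_def strip_def axis_def algebra_simps)
    qed
    moreover have "q \<noteq> 0"
    proof
      assume "q = 0"
      then have "\<theta> = of_int k *\<^sub>R ((2 * pi) *\<^sub>R axis i 1)" by (simp add: q_def)
      then have "\<theta> $ j = 2 * pi * of_int (if j = i then k else 0)" for j by (simp add: axis_def)
      then show False using \<theta> unfolding dual_lattice_def by blast
    qed
    ultimately have "norm (partial_derivs [] m q)
        \<le> C (count_list []) * norm q powr (- real (length ([] :: 'd list)))" "q \<noteq> 0"
      using m unfolding singular_multiplier_def by blast+
    moreover have "m q = m \<theta>" unfolding q_def by (rule periodic_of_int) (rule per)
    ultimately show ?thesis by simp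
  qed
  ultimately show ?thesis using per countable_dual_lattice unfolding strip_bounded_def by blast
qed

lemma emeasure_lborel_cbox_eq_measure:
  "emeasure lborel (cbox a b) = ennreal (measure lborel (cbox a b))"
  by (rule emeasure_eq_ennreal_measure) (metis emeasure_lborel_cbox_finite infinity_ennreal_def order_less_irrefl)

text \<open>The integrand is at most \<open>2 powr (- k (d + 1))\<close> outside the cube of half side length \<open>2 ^ k * r\<close>, and
  the cubes have measure of order \<open>(2 ^ k * r) ^ d\<close>. The exponent \<open>d + 1\<close> is the smallest integer for
  which the dyadic series converges.\<close>

lemma nn_integral_truncated_power:
  assumes r: "0 < r"
  shows "(\<integral>\<^sup>+ \<theta>. ennreal (min 1 ((r / norm \<theta>) ^ Suc CARD('d))) \<partial>(lborel :: (real ^ 'd::finite) measure))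
      \<le> ennreal (2 * 4 ^ CARD('d) * r ^ CARD('d))"
proof -
  let ?d = "CARD('d)"
  define B where "B k = (cbox (\<chi> j. - (2 ^ Suc k * r)) (\<chi> j. 2 ^ Suc k * r) :: (real ^ 'd) set)" for k :: nat
  define c where "c k = (1 / 2 ^ k :: real) ^ Suc ?d" for k :: nat
  have c0: "0 \<le> c k" for k by (simp add: c_def)
  have [measurable]: "B k \<in> sets borel" for k by (simp add: B_def)
  have B: "emeasure lborel (B k) = ennreal ((2 * (2 ^ Suc k * r)) ^ ?d)" for k
  proof -
    have "(0 :: real ^ 'd) \<in> cbox (\<chi> j. - (2 ^ Suc k * r)) (\<chi> j. 2 ^ Suc k * r)"
      using r by (simp add: mem_box_cart)
    then have "cbox (\<chi> j. - (2 ^ Suc k * r)) (\<chi> j. 2 ^ Suc k * r :: real ^ 'd) \<noteq> {}" by blast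
    then have "measure lborel (B k) = (2 * (2 ^ Suc k * r)) ^ ?d"
      unfolding B_def by (subst content_cbox_cart) (simp_all add: ac_simps)
    then show ?thesis unfolding B_def by (simp only: emeasure_lborel_cbox_eq_measure)
  qed
  have in_B: "\<theta> \<in> B k" if "norm \<theta> \<le> 2 ^ Suc k * r" for \<theta> k
  proof -
    have "\<bar>\<theta> $ j\<bar> \<le> 2 ^ Suc k * r" for j using component_le_norm_cart[of \<theta> j] that by linarith
    then show ?thesis unfolding B_def mem_box_cart by (auto simp: abs_le_iff) (metis minus_le_iff)
  qed
  have pt: "ennreal (min 1 ((r / norm \<theta>) ^ Suc ?d)) \<le> (\<Sum>k. ennreal (c k) * indicator (B k) \<theta>)"
    for \<theta> :: "real ^ 'd"
  proof -
    have "\<exists>k. min 1 ((r / norm \<theta>) ^ Suc ?d) \<le> c k \<and> \<theta> \<in> B k"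
    proof (cases "norm \<theta> \<le> r")
      case True
      then have "\<theta> \<in> B 0" using r by (intro in_B) simp
      then show ?thesis by (intro exI[of _ 0]) (simp add: c_def)
    next
      case False
      define k where "k = nat \<lfloor>log 2 (norm \<theta> / r)\<rfloor>"
      have g: "1 < norm \<theta> / r" using False r by simp
      have n0: "0 < norm \<theta>" using False r by linarith
      have l: "0 < log 2 (norm \<theta> / r)" using g by (subst zero_less_log_cancel_iff) linarith+
      have 1: "real k \<le> log 2 (norm \<theta> / r)" "log 2 (norm \<theta> / r) < real (Suc k)"
        using l by (auto simp: k_def) linarith+
      have "2 powr real k \<le> norm \<theta> / r" using 1(1) g by (subst (asm) le_log_iff) auto
      then have lo: "2 ^ k \<le> norm \<theta> / r" by (simp add: powr_realpow)
      have "norm \<theta> / r < 2 powr real (Suc k)" using 1(2) g by (subst (asm) log_less_iff) auto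
      then have "norm \<theta> / r < 2 ^ Suc k" by (simp only: powr_realpow)
      then have "\<theta> \<in> B k" using r by (intro in_B) (simp add: pos_divide_less_eq)
      moreover have "r / norm \<theta> \<le> 1 / 2 ^ k"
        using lo r n0 by (simp add: field_simps)
      then have "(r / norm \<theta>) ^ Suc ?d \<le> c k"
        unfolding c_def using r by (intro power_mono) auto
      ultimately show ?thesis by (intro exI[of _ k]) auto
    qed
    then obtain k where k: "min 1 ((r / norm \<theta>) ^ Suc ?d) \<le> c k" "\<theta> \<in> B k" by blast
    have "ennreal (min 1 ((r / norm \<theta>) ^ Suc ?d)) \<le> (\<Sum>k\<in>{k}. ennreal (c k) * indicator (B k) \<theta>)"
      using k by (simp add: ennreal_leI)
    also have "\<dots> \<le> (\<Sum>k. ennreal (c k) * indicator (B k) \<theta>)"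
      by (rule sum_le_suminf) auto
    finally show ?thesis .
  qed
  have "(\<integral>\<^sup>+ \<theta>. ennreal (min 1 ((r / norm \<theta>) ^ Suc ?d)) \<partial>(lborel :: (real ^ 'd) measure))
     \<le> (\<integral>\<^sup>+ \<theta>. (\<Sum>k. ennreal (c k) * indicator (B k) \<theta>) \<partial>lborel)"
    by (intro nn_integral_mono pt)
  also have "\<dots> = (\<Sum>k. \<integral>\<^sup>+ \<theta>. ennreal (c k) * indicator (B k) \<theta> \<partial>lborel)"
    by (rule nn_integral_suminf) measurable
  also have "\<dots> = (\<Sum>k. ennreal (4 ^ ?d * r ^ ?d * (1/2) ^ k))"
  proof (intro suminf_cong)
    fix k
    have "(\<integral>\<^sup>+ \<theta>. ennreal (c k) * indicator (B k) \<theta> \<partial>lborel) = ennreal (c k) * emeasure lborel (B k)"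
      by (rule nn_integral_cmult_indicator) simp
    also have "\<dots> = ennreal (c k * (2 * (2 ^ Suc k * r)) ^ ?d)"
      using r c0[of k] by (simp add: B ennreal_mult)
    also have "c k * (2 * (2 ^ Suc k * r)) ^ ?d = 4 ^ ?d * r ^ ?d * (1/2) ^ k"
    proof -
      have "2 * (2 ^ Suc k * r) = 2 ^ k * (4 * r)" by simp
      then have "c k * (2 * (2 ^ Suc k * r)) ^ ?d = (1 / 2 ^ k) * ((1 / 2 ^ k) ^ ?d * (2 ^ k) ^ ?d) * (4 * r) ^ ?d"
        unfolding c_def by (simp only: power_mult_distrib power_Suc mult.assoc)
      also have "(1 / 2 ^ k :: real) ^ ?d * (2 ^ k) ^ ?d = 1" by (simp add: power_mult_distrib [symmetric])
      finally show ?thesis by (simp add: power_mult_distrib power_divide)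
    qed
    finally show "(\<integral>\<^sup>+ \<theta>. ennreal (c k) * indicator (B k) \<theta> \<partial>lborel) = ennreal (4 ^ ?d * r ^ ?d * (1/2) ^ k)" .
  qed
  also have "\<dots> = ennreal (2 * 4 ^ ?d * r ^ ?d)"
  proof (rule suminf_ennreal_eq)
    have "(\<lambda>k. (1/2 :: real) ^ k) sums 2" using geometric_sums[of "1/2 :: real"] by simp
    from sums_mult[OF this, of "4 ^ ?d * r ^ ?d"]
    show "(\<lambda>k. 4 ^ ?d * r ^ ?d * (1/2 :: real) ^ k) sums (2 * 4 ^ ?d * r ^ ?d)" by (simp add: ac_simps)
  qed (use r in simp)
  finally show ?thesis .
qed

section \<open>Decay of singular kernels\<close>

text \<open>Near 0 the differences are merely bounded; at distance more than \<open>2 s h\<close> from 0 the bound on the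
  derivatives of order \<open>s\<close> applies. The two regimes meet in the truncated power.\<close>

lemma fdiff_multiplier_bound:
  fixes m :: "real ^ 'd::finite \<Rightarrow> complex"
  assumes m: "singular_multiplier C m" and h: "0 < h" and s: "s = Suc CARD('d)"
    and A: "2 ^ s * \<bar>C (count_list [])\<bar> + \<bar>C (count_list (replicate s i))\<bar> \<le> A"
  shows "AE \<theta> in lborel. \<theta> \<in> torus \<longrightarrow>
     norm ((fdiff (h *\<^sub>R axis i 1) ^^ s) m \<theta>) \<le> A * min 1 ((2 * (real s * h) / norm \<theta>) ^ s)"
proof -
  let ?D = "(fdiff (h *\<^sub>R axis i 1) ^^ s) m"
  have "strip_bounded i (2 ^ s * C (count_list [])) ?D"
    by (rule strip_bounded_fdiff_power[OF strip_bounded_multiplier[OF m]])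
  then obtain N where N: "countable N" "\<And>\<theta>. \<theta> \<in> strip i - N \<Longrightarrow> norm (?D \<theta>) \<le> 2 ^ s * C (count_list [])"
    by (auto simp: strip_bounded_def)
  have "countable (insert 0 N)" using N(1) by simp
  then have "AE \<theta> in lborel. \<theta> \<notin> insert 0 N"
    by (intro AE_not_in countable_imp_null_set_lborel)
  then show ?thesis
  proof (rule eventually_mono, intro impI)
    fix \<theta> :: "real ^ 'd" assume \<theta>: "\<theta> \<notin> insert 0 N" "\<theta> \<in> torus"
    let ?r = "2 * (real s * h)"
    have A0: "0 \<le> 2 ^ s * \<bar>C (count_list [])\<bar>" "0 \<le> \<bar>C (count_list (replicate s i))\<bar>" by simp_all
    have n0: "0 < norm \<theta>" using \<theta> by simp
    show "norm (?D \<theta>) \<le> A * min 1 ((?r / norm \<theta>) ^ s)"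
    proof (cases "?r \<le> norm \<theta>")
      case True
      have "norm (?D \<theta>) \<le> C (count_list (replicate s i)) * (2 * h / norm \<theta>) ^ s"
        using fdiff_multiplier_bound_far[OF m \<theta>(2) _ h True] \<theta>(1) by simp
      also have "C (count_list (replicate s i)) \<le> A" using A A0 by linarith
      then have "C (count_list (replicate s i)) * (2 * h / norm \<theta>) ^ s \<le> A * (2 * h / norm \<theta>) ^ s"
        using h by (intro mult_right_mono) auto
      also have "0 \<le> A" using A A0 by linarith
      then have "A * (2 * h / norm \<theta>) ^ s \<le> A * (?r / norm \<theta>) ^ s"
        using h s by (intro mult_left_mono power_mono divide_right_mono) auto
      also have "(?r / norm \<theta>) ^ s \<le> 1" using True n0 h by (intro power_le_one) auto
      then have "(?r / norm \<theta>) ^ s = min 1 ((?r / norm \<theta>) ^ s)" by simp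
      finally show ?thesis .
    next
      case False
      then have "1 \<le> (?r / norm \<theta>) ^ s" using n0 by (intro one_le_power) simp
      then have min1: "min 1 ((?r / norm \<theta>) ^ s) = 1" by simp
      have "norm (?D \<theta>) \<le> 2 ^ s * C (count_list [])"
        using N(2)[of \<theta>] \<theta> by (auto simp: strip_def mem_torus)
      moreover have "2 ^ s * C (count_list []) \<le> 2 ^ s * \<bar>C (count_list [])\<bar>" by (intro mult_left_mono) auto
      ultimately have "norm (?D \<theta>) \<le> A" using A A0 by linarith
      then show ?thesis unfolding min1 by simp
    qed
  qed
qed

lemma conv_kernel_multiplier:
  "conv_kernel (fourier_multiplier m) x
    = (LINT \<theta>:torus|lborel. m \<theta> * cis (\<theta> \<bullet> real_vec x)) / (2 * of_real pi) ^ CARD('d)"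
  for x :: "int ^ 'd::finite"
proof -
  have "fourier (\<lambda>y. if y = 0 then 1 else 0) \<theta> = 1" for \<theta> :: "real ^ 'd"
  proof -
    have "fourier (\<lambda>y. if y = 0 then 1 else 0) \<theta>
        = (\<Sum>\<^sub>\<infinity>y\<in>{0}. (if y = 0 then 1 else 0) * cis (- (\<theta> \<bullet> real_vec y)))"
      unfolding fourier_def by (rule infsum_cong_neutral) auto
    also have "\<dots> = 1" by (simp add: real_vec_def zero_vec_def [symmetric])
    finally show ?thesis .
  qed
  then show ?thesis by (simp add: conv_kernel_def fourier_multiplier_def inverse_fourier_def)
qed

lemma norm_conv_kernel_le:
  "norm (conv_kernel (fourier_multiplier m) x) \<le> norm (LINT \<theta>:torus|lborel. m \<theta> * cis (\<theta> \<bullet> real_vec x))"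
  for x :: "int ^ 'd::finite"
proof -
  have "1 \<le> (2 * pi) ^ CARD('d)" using pi_gt3 by (intro one_le_power) auto
  then have "norm (LINT \<theta>:torus|lborel. m \<theta> * cis (\<theta> \<bullet> real_vec x)) / (2 * pi) ^ CARD('d)
      \<le> norm (LINT \<theta>:torus|lborel. m \<theta> * cis (\<theta> \<bullet> real_vec x)) / 1"
    by (intro divide_left_mono) auto
  then show ?thesis by (simp add: conv_kernel_multiplier norm_divide norm_power norm_mult)
qed

lemma max_component:
  fixes x :: "int ^ 'd::finite"
  assumes "x \<noteq> 0"
  obtains i where "x $ i \<noteq> 0" "bracket x \<le> real (Suc CARD('d)) * \<bar>real_of_int (x $ i)\<bar>"
proof -
  have "Max (range (\<lambda>j. \<bar>x $ j\<bar>)) \<in> range (\<lambda>j. \<bar>x $ j\<bar>)" by (intro Max_in) auto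
  then obtain i where i: "\<bar>x $ i\<bar> = Max (range (\<lambda>j. \<bar>x $ j\<bar>))" by (auto simp: image_iff)
  have le: "\<bar>x $ j\<bar> \<le> \<bar>x $ i\<bar>" for j unfolding i by (rule Max_ge) auto
  have nz: "x $ i \<noteq> 0"
  proof
    assume "x $ i = 0"
    then have "x $ j = 0" for j using le[of j] by simp
    then show False using assms by (simp add: vec_eq_iff)
  qed
  have "norm (real_vec x) \<le> (\<Sum>j\<in>UNIV. \<bar>real_of_int (x $ j)\<bar>)"
    using norm_le_l1_cart[of "real_vec x"] by (simp add: real_vec_def)
  also have "\<dots> \<le> (\<Sum>j\<in>(UNIV :: 'd set). \<bar>real_of_int (x $ i)\<bar>)"
    by (intro sum_mono) (use le in \<open>simp add: of_int_abs [symmetric] del: of_int_abs\<close>)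
  also have "\<dots> = real CARD('d) * \<bar>real_of_int (x $ i)\<bar>" by simp
  finally have "norm (real_vec x) \<le> real CARD('d) * \<bar>real_of_int (x $ i)\<bar>" .
  moreover have "1 \<le> \<bar>real_of_int (x $ i)\<bar>" using nz by linarith
  ultimately have "bracket x \<le> real (Suc CARD('d)) * \<bar>real_of_int (x $ i)\<bar>"
    by (simp add: bracket_def algebra_simps)
  then show ?thesis using that nz by blast
qed

lemma norm_integral_le_nn:
  fixes g :: "real ^ 'd::finite \<Rightarrow> complex"
  assumes int: "set_integrable lborel torus g"
    and AE: "AE \<theta> in lborel. \<theta> \<in> torus \<longrightarrow> norm (g \<theta>) \<le> A * G \<theta>"
    and G: "\<And>\<theta>. 0 \<le> G \<theta>" "(\<integral>\<^sup>+ \<theta>. ennreal (G \<theta>) \<partial>lborel) \<le> ennreal I" "0 \<le> I"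
    and [measurable]: "G \<in> borel_measurable borel" and A: "0 \<le> A"
  shows "norm (LINT \<theta>:torus|lborel. g \<theta>) \<le> A * I"
proof -
  have "ennreal (norm (LINT \<theta>:torus|lborel. g \<theta>))
      \<le> (\<integral>\<^sup>+ \<theta>. ennreal (norm (indicator torus \<theta> *\<^sub>R g \<theta>)) \<partial>lborel)"
    unfolding set_lebesgue_integral_def
    by (rule integral_norm_bound_ennreal) (use int in \<open>simp add: set_integrable_def\<close>)
  also have "\<dots> \<le> (\<integral>\<^sup>+ \<theta>. ennreal A * ennreal (G \<theta>) \<partial>lborel)"
  proof (rule nn_integral_mono_AE)
    show "AE \<theta> in lborel. ennreal (norm (indicator torus \<theta> *\<^sub>R g \<theta>)) \<le> ennreal A * ennreal (G \<theta>)"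
      using AE
    proof (rule eventually_mono)
      fix \<theta> assume "\<theta> \<in> torus \<longrightarrow> norm (g \<theta>) \<le> A * G \<theta>"
      then have "norm (indicator torus \<theta> *\<^sub>R g \<theta>) \<le> A * G \<theta>"
        using A G(1)[of \<theta>] by (auto simp: indicator_def)
      then show "ennreal (norm (indicator torus \<theta> *\<^sub>R g \<theta>)) \<le> ennreal A * ennreal (G \<theta>)"
        using A G(1)[of \<theta>] by (simp add: ennreal_mult [symmetric] ennreal_leI)
    qed
  qed
  also have "\<dots> = ennreal A * (\<integral>\<^sup>+ \<theta>. ennreal (G \<theta>) \<partial>lborel)" by (rule nn_integral_cmult) measurable
  also have "\<dots> \<le> ennreal A * ennreal I" by (intro mult_left_mono G(2)) simp
  also have "\<dots> = ennreal (A * I)" using A G(3) by (simp add: ennreal_mult)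
  finally show ?thesis using A G(3) by (simp add: ennreal_le_iff)
qed

text \<open>With \<open>h = pi / \<bar>x $ i\<bar>\<close> for the largest coordinate of \<open>x\<close>, the Fourier integral of \<open>m\<close> equals that of
  the iterated difference of \<open>m\<close> up to the factor \<open>2 ^ s\<close>. The latter is integrated with absolute
  values and is of order \<open>h ^ d\<close>, i.e. \<open>bracket x powr - d\<close>.\<close>

lemma singular_kernel_decay:
  fixes C :: "('d::finite \<Rightarrow> nat) \<Rightarrow> real"
  shows "\<exists>M\<ge>1. \<forall>K x. singular_integral_operator C K \<longrightarrow>
            norm (conv_kernel K x) \<le> M * bracket x powr - real CARD('d)"
proof -
  let ?d = "CARD('d)" and ?s = "Suc CARD('d)"
  define A where "A = 2 ^ ?s * \<bar>C (count_list [])\<bar> + (\<Sum>i\<in>UNIV. \<bar>C (count_list (replicate ?s i))\<bar>)"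
  define T where "T = measure lborel (torus :: (real ^ 'd) set)"
  \<comment> \<open>The integrand is truncated at radius \<open>2 s h\<close>, which is at most \<open>R / bracket x\<close>
      since \<open>bracket x \<le> s * \<bar>x $ i\<bar>\<close>; \<open>T\<close> serves for the trivial bound at \<open>x = 0\<close>.\<close>
  define R where "R = 2 * real ?s * real ?s * pi"
  define M where "M = 1 + A * (2 * 4 ^ ?d * R ^ ?d) + A * T"
  have A0: "0 \<le> A" unfolding A_def by (intro add_nonneg_nonneg sum_nonneg) auto
  have R0: "0 \<le> R" by (simp add: R_def)
  have M: "A * (2 * 4 ^ ?d * R ^ ?d) \<le> M" "A * T \<le> M" "1 \<le> M"
    using A0 R0 by (simp_all add: M_def T_def)
  have "norm (conv_kernel K x) \<le> M * bracket x powr - real ?d"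
    if K: "singular_integral_operator C K" for K and x :: "int ^ 'd"
  proof -
    obtain m where m: "singular_multiplier C m" and Km: "K = fourier_multiplier m"
      using K by (auto simp: singular_integral_operator_def)
    let ?I = "LINT \<theta>:torus|lborel. m \<theta> * cis (\<theta> \<bullet> real_vec x)"
    have "norm ?I \<le> M * bracket x powr - real ?d"
    proof (cases "x = 0")
      case True
      let ?i = "undefined :: 'd"
      obtain N where N: "countable N" "\<And>\<theta>. \<theta> \<in> strip ?i - N \<Longrightarrow> norm (m \<theta>) \<le> C (count_list [])"
        using strip_bounded_multiplier[OF m, of ?i] by (auto simp: strip_bounded_def)
      have "(2::real) ^ 0 \<le> 2 ^ ?s" by (rule power_increasing) auto
      then have "1 * \<bar>C (count_list [])\<bar> \<le> 2 ^ ?s * \<bar>C (count_list [])\<bar>" by (intro mult_right_mono) auto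
      moreover have "0 \<le> (\<Sum>i\<in>UNIV. \<bar>C (count_list (replicate ?s i))\<bar>)" by (intro sum_nonneg) simp
      ultimately have CA: "C (count_list []) \<le> A" unfolding A_def by linarith
      have AE: "AE \<theta> in lborel. \<theta> \<notin> N"
        by (rule AE_not_in) (rule countable_imp_null_set_lborel[OF N(1)])
      have "norm ?I \<le> A * T"
      proof (rule norm_integral_le_nn[where G = "indicator torus"])
        show "set_integrable lborel torus (\<lambda>\<theta>. m \<theta> * cis (\<theta> \<bullet> real_vec x))"
          by (rule integrable_strip_bounded[OF strip_bounded_multiplier[OF m, of ?i]])
        show "AE \<theta> in lborel. \<theta> \<in> torus \<longrightarrow> norm (m \<theta> * cis (\<theta> \<bullet> real_vec x)) \<le> A * indicator torus \<theta>"
          using AE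
        proof (rule eventually_mono, intro impI)
          fix \<theta> assume \<theta>: "\<theta> \<notin> N" "\<theta> \<in> torus"
          then have "norm (m \<theta>) \<le> C (count_list [])" using N(2)[of \<theta>] by (auto simp: strip_def mem_torus)
          then show "norm (m \<theta> * cis (\<theta> \<bullet> real_vec x)) \<le> A * indicator torus \<theta>"
            using CA \<theta> by (simp add: norm_mult)
        qed
        show "(\<integral>\<^sup>+ \<theta>. ennreal (indicator torus \<theta>) \<partial>(lborel :: (real ^ 'd) measure)) \<le> ennreal T"
          by (simp add: T_def torus_def ennreal_indicator emeasure_lborel_cbox_eq_measure)
        show "(indicator torus :: real ^ 'd \<Rightarrow> real) \<in> borel_measurable borel" by (simp add: torus_def)
      qed (use A0 in \<open>auto simp: T_def\<close>)
      then show ?thesis using M(2) True by (simp add: bracket_def real_vec_def zero_vec_def [symmetric])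
    next
      case False
      then obtain i where i: "x $ i \<noteq> 0" "bracket x \<le> real ?s * \<bar>real_of_int (x $ i)\<bar>"
        by (rule max_component)
      define h where "h = pi / \<bar>real_of_int (x $ i)\<bar>"
      have h: "0 < h" using i by (simp add: h_def)
      let ?r = "2 * (real ?s * h)"
      let ?D = "(fdiff (h *\<^sub>R axis i 1) ^^ ?s) m"
      have AE: "AE \<theta> in lborel. \<theta> \<in> torus \<longrightarrow> norm (?D \<theta>) \<le> A * min 1 ((?r / norm \<theta>) ^ ?s)"
        by (rule fdiff_multiplier_bound[OF m h refl]) (use member_le_sum[of i UNIV "\<lambda>i. \<bar>C (count_list (replicate ?s i))\<bar>"] in \<open>simp add: A_def\<close>)
      have "norm (LINT \<theta>:torus|lborel. ?D \<theta> * cis (\<theta> \<bullet> real_vec x)) \<le> A * (2 * 4 ^ ?d * ?r ^ ?d)"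
      proof (rule norm_integral_le_nn[where G = "\<lambda>\<theta>. min 1 ((?r / norm \<theta>) ^ ?s)"])
        show "set_integrable lborel torus (\<lambda>\<theta>. ?D \<theta> * cis (\<theta> \<bullet> real_vec x))"
          by (rule integrable_strip_bounded[OF strip_bounded_fdiff_power[OF strip_bounded_multiplier[OF m]]])
        show "AE \<theta> in lborel. \<theta> \<in> torus \<longrightarrow>
            norm (?D \<theta> * cis (\<theta> \<bullet> real_vec x)) \<le> A * min 1 ((?r / norm \<theta>) ^ ?s)"
          using AE by (simp only: norm_mult norm_cis mult_1_right)
        show "(\<integral>\<^sup>+ \<theta>. ennreal (min 1 ((?r / norm \<theta>) ^ ?s)) \<partial>(lborel :: (real ^ 'd) measure))
            \<le> ennreal (2 * 4 ^ ?d * ?r ^ ?d)"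
          by (rule nn_integral_truncated_power) (use h in simp)
        show "(\<lambda>\<theta> :: real ^ 'd. min 1 ((?r / norm \<theta>) ^ ?s)) \<in> borel_measurable borel" by measurable
      qed (use h A0 in auto)
      also have "(LINT \<theta>:torus|lborel. ?D \<theta> * cis (\<theta> \<bullet> real_vec x)) = 2 ^ ?s * ?I"
        using fourier_integral_fdiff_power[OF strip_bounded_multiplier[OF m] i(1), of ?s] by (simp only: h_def)
      also have "norm (2 ^ ?s * ?I) = 2 ^ ?s * norm ?I" by (simp add: norm_mult norm_power)
      finally have 1: "2 ^ ?s * norm ?I \<le> A * (2 * 4 ^ ?d * ?r ^ ?d)" .
      have "(2::real) ^ 0 \<le> 2 ^ ?s" by (rule power_increasing) auto
      then have "1 * norm ?I \<le> 2 ^ ?s * norm ?I" by (intro mult_right_mono) auto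
      then have "norm ?I \<le> A * (2 * 4 ^ ?d * ?r ^ ?d)" using 1 by linarith
      also have "?r ^ ?d \<le> (R / bracket x) ^ ?d"
      proof (rule power_mono)
        have b: "0 < bracket x" using bracket_ge_1[of x] by simp
        have "?r * bracket x \<le> ?r * (real ?s * \<bar>real_of_int (x $ i)\<bar>)"
          using h i(2) by (intro mult_left_mono) auto
        also have "\<dots> = R" using i(1) by (simp add: h_def R_def)
        finally show "?r \<le> R / bracket x" using b by (simp add: pos_le_divide_eq)
      qed (use h in simp)
      also have "(R / bracket x) ^ ?d = R ^ ?d * bracket x powr - real ?d"
        using bracket_ge_1[of x] by (simp add: power_divide powr_minus powr_realpow field_simps)
      finally have "norm ?I \<le> A * (2 * 4 ^ ?d * R ^ ?d) * bracket x powr - real ?d"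
        using A0 by (simp add: mult_left_mono mult.assoc)
      also have "\<dots> \<le> M * bracket x powr - real ?d" by (intro mult_right_mono M) simp
      finally show ?thesis .
    qed
    then show ?thesis using norm_conv_kernel_le[of m x] by (simp add: Km)
  qed
  then show ?thesis using M(3) by blast
qed

section \<open>Cuts and lightest spanning edge sets\<close>

text \<open>Edge \<open>j\<close> of a path \<open>x\<close> joins \<open>x (j - 1)\<close> to \<open>x j\<close>; edges are thus numbered from 1.\<close>

definition crosses :: "(nat \<Rightarrow> 'a) \<Rightarrow> 'a set \<Rightarrow> nat \<Rightarrow> bool" where
  "crosses x A j \<longleftrightarrow> (x (j - 1) \<in> A) \<noteq> (x j \<in> A)"

text \<open>The cut form of the statement that the edges in \<open>F\<close> connect every visited point to \<open>x 0\<close> or \<open>x n\<close>.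
  With cuts instead of connecting paths, exchange arguments reduce to symmetric differences of sets.\<close>

definition spans :: "(nat \<Rightarrow> 'a) \<Rightarrow> nat \<Rightarrow> nat set \<Rightarrow> bool" where
  "spans x n F \<longleftrightarrow> F \<subseteq> {1..n} \<and>
     (\<forall>D. D \<subseteq> x ` {0..n} \<and> D \<noteq> {} \<and> x 0 \<notin> D \<and> x n \<notin> D \<longrightarrow> (\<exists>e\<in>F. crosses x D e))"

definition lightest_spanning :: "(nat \<Rightarrow> 'a) \<Rightarrow> nat \<Rightarrow> (nat \<Rightarrow> real) \<Rightarrow> nat set \<Rightarrow> bool" where
  "lightest_spanning x n w F \<longleftrightarrow> spans x n F \<and> (\<forall>F'. spans x n F' \<longrightarrow> sum w F \<le> sum w F')"

text \<open>Crossing is additive modulo 2 in the set. All the exchange arguments below rest on this.\<close>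

lemma crosses_sym_diff:
  "crosses x (sym_diff A D) j \<longleftrightarrow> crosses x A j \<noteq> crosses x D j"
  by (auto simp: crosses_def)

lemma crosses_between:
  assumes "a < b" "(x a \<in> A) \<noteq> (x b \<in> A)"
  shows "\<exists>j. a < j \<and> j \<le> b \<and> crosses x A j"
  using assms
proof (induction b)
  case 0
  then show ?case by simp
next
  case (Suc b)
  show ?case
  proof (cases "crosses x A (Suc b)")
    case True
    then show ?thesis using Suc.prems(1) by blast
  next
    case False
    then have "(x a \<in> A) \<noteq> (x b \<in> A)" using Suc.prems by (auto simp: crosses_def)
    moreover from this have "a < b" using Suc.prems by (metis less_SucE)
    ultimately show ?thesis using Suc.IH by (meson le_SucI)
  qed
qed

lemma closed_walk_crosses_twice:
  assumes "D \<subseteq> x ` {0..n}" "D \<noteq> {}" "x 0 \<notin> D" "x n \<notin> D"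
  shows "\<exists>i j. i \<in> {1..n} \<and> j \<in> {1..n} \<and> i \<noteq> j \<and> crosses x D i \<and> crosses x D j"
proof -
  obtain m where m: "m \<le> n" "x m \<in> D" using assms(1,2) by fastforce
  have "0 < m" "m < n" using m assms(3,4) by (auto intro: gr0I simp: le_less)
  then obtain i j where "0 < i" "i \<le> m" "crosses x D i" "m < j" "j \<le> n" "crosses x D j"
    using crosses_between[of 0 m x D] crosses_between[of m n x D] assms(3,4) m by blast
  then show ?thesis by (intro exI[of _ i] exI[of _ j]) auto
qed

text \<open>At the first step out of \<open>A\<close>, irreducibility yields a later vertex that coincides with one of the
  vertices before this step, so it lies in \<open>A\<close>. The path must therefore enter \<open>A\<close> again and leave
  it again.\<close>

lemma irreducible_crosses_thrice:
  assumes irr: "\<forall>j<n. x ` {0..j} \<inter> x ` {Suc j..n} \<noteq> {}"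
    and A: "x 0 \<in> A" "x n \<notin> A"
  shows "3 \<le> card {j \<in> {1..n}. crosses x A j}"
proof -
  define j where "j = (LEAST j. x j \<notin> A)"
  have jA: "x j \<notin> A" unfolding j_def by (rule LeastI[of "\<lambda>j. x j \<notin> A", OF A(2)])
  have jn: "j \<le> n" unfolding j_def by (rule Least_le[of "\<lambda>j. x j \<notin> A", OF A(2)])
  have before: "x i \<in> A" if "i < j" for i
    using not_less_Least[of i "\<lambda>j. x j \<notin> A"] that by (auto simp: j_def)
  have j0: "0 < j" using jA A(1) by (auto intro: gr0I)
  have "x ` {0..j-1} \<inter> x ` {j..n} \<noteq> {}" using irr[rule_format, of "j-1"] j0 jn by simp
  then obtain i i' where i: "i \<le> j - 1" "j \<le> i'" "i' \<le> n" "x i = x i'" by fastforce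
  have "x i \<in> A" using before i(1) j0 by simp
  then have i'A: "x i' \<in> A" using i(4) by simp
  have "j < i'" using i'A jA i(2) by (metis le_less)
  moreover have "i' < n" using i'A A(2) i(3) by (metis le_less)
  ultimately obtain k l where kl: "j < k" "k \<le> i'" "crosses x A k" "i' < l" "l \<le> n" "crosses x A l"
    using crosses_between[of j i' x A] crosses_between[of i' n x A] A i'A jA by blast
  have "crosses x A j" using before[of "j-1"] jA j0 by (simp add: crosses_def)
  then have "{j,k,l} \<subseteq> {j \<in> {1..n}. crosses x A j}" using kl j0 jn by auto
  then have "card {j,k,l} \<le> card {j \<in> {1..n}. crosses x A j}" by (intro card_mono) auto
  moreover have "card {j,k,l} = 3" using kl by auto
  ultimately show ?thesis by simp
qed

lemma ex_lightest_spanning: "\<exists>F. lightest_spanning x n w F"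
proof -
  have "spans x n {1..n}"
    unfolding spans_def using closed_walk_crosses_twice[of _ x n] by blast
  moreover have "finite {F. spans x n F}"
    by (rule finite_subset[of _ "Pow {1..n}"]) (auto simp: spans_def)
  ultimately obtain F where "is_arg_min (sum w) (\<lambda>F. F \<in> {F. spans x n F}) F"
    using ex_is_arg_min_if_finite[of "{F. spans x n F}" "sum w"] by blast
  then show ?thesis
    by (intro exI[of _ F]) (auto simp: lightest_spanning_def is_arg_min_linorder)
qed

text \<open>In a spanning forest, \<open>D\<close> would be the set of points that lose their connection to the roots when
  \<open>e\<close> is deleted. Here it comes from minimality: \<open>F - {e}\<close> is lighter and hence does not span.\<close>

lemma fundamental_cut_exists:
  assumes F: "lightest_spanning x n w F" and w: "\<And>e. 0 < w e" and e: "e \<in> F"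
  shows "\<exists>D. D \<subseteq> x ` {0..n} \<and> D \<noteq> {} \<and> x 0 \<notin> D \<and> x n \<notin> D \<and> {e' \<in> F. crosses x D e'} = {e}"
proof -
  have sp: "spans x n F" and "finite F"
    using F by (auto simp: lightest_spanning_def spans_def finite_subset)
  then have "sum w (F - {e}) < sum w F" using e w[of e] by (simp add: sum_diff1)
  then have "\<not> spans x n (F - {e})" using F unfolding lightest_spanning_def by (meson not_le)
  moreover have "F - {e} \<subseteq> {1..n}" using sp unfolding spans_def by blast
  ultimately obtain D where D: "D \<subseteq> x ` {0..n}" "D \<noteq> {}" "x 0 \<notin> D" "x n \<notin> D"
      "\<forall>e'\<in>F-{e}. \<not> crosses x D e'"
    unfolding spans_def by blast
  moreover obtain e' where "e' \<in> F" "crosses x D e'" using sp D unfolding spans_def by blast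
  ultimately show ?thesis by (intro exI[of _ D]) auto
qed

lemma uncrossed_imp_empty:
  assumes "spans x n F" "D \<subseteq> x ` {0..n}" "x 0 \<notin> D" "x n \<notin> D" "\<forall>e\<in>F. \<not> crosses x D e"
  shows "D = {}"
  using assms unfolding spans_def by blast

text \<open>The usual exchange property: replacing \<open>e\<close> by another edge \<open>f\<close> across its fundamental cut
  preserves spanning. A set \<open>D'\<close> that witnesses the contrary would be crossed in \<open>F\<close> by \<open>e\<close> only, like \<open>D\<close>.
  Then no edge of \<open>F\<close> crosses \<open>sym_diff D D'\<close>, so \<open>D = D'\<close>, which \<open>f\<close> crosses.\<close>

lemma exchange_weight_le:
  assumes F: "lightest_spanning x n w F" and e: "e \<in> F"
    and D: "D \<subseteq> x ` {0..n}" "x 0 \<notin> D" "x n \<notin> D" "{e' \<in> F. crosses x D e'} = {e}"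
    and f: "f \<in> {1..n}" "crosses x D f"
  shows "w e \<le> w f"
proof (cases "f \<in> F")
  case True
  then show ?thesis using D(4) f(2) by auto
next
  case False
  have sp: "spans x n F" and fin: "finite F"
    using F by (auto simp: lightest_spanning_def spans_def finite_subset)
  have "\<exists>e'\<in>insert f (F - {e}). crosses x D' e'"
    if D': "D' \<subseteq> x ` {0..n}" "D' \<noteq> {}" "x 0 \<notin> D'" "x n \<notin> D'" for D'
  proof (rule ccontr)
    assume no: "\<not> ?thesis"
    have "\<exists>e'\<in>F. crosses x D' e'" using sp D' unfolding spans_def by blast
    then have "{e' \<in> F. crosses x D' e'} = {e}" using no by blast
    then have "\<forall>e'\<in>F. \<not> crosses x (sym_diff D D') e'" using D(4) by (auto simp: crosses_sym_diff)
    then have "sym_diff D D' = {}"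
      using uncrossed_imp_empty[OF sp, of "sym_diff D D'"] D D' by blast
    then have "D = D'" by blast
    then show False using no f(2) by blast
  qed
  moreover have "insert f (F - {e}) \<subseteq> {1..n}" using sp f(1) unfolding spans_def by blast
  ultimately have "spans x n (insert f (F - {e}))" unfolding spans_def by blast
  then have "sum w F \<le> sum w (insert f (F - {e}))" using F by (simp add: lightest_spanning_def)
  then show ?thesis using False e fin by (simp add: sum_diff1)
qed

text \<open>A path from endpoint to endpoint crosses a fundamental cut, which contains neither endpoint, a second time, and
  the second edge lies outside \<open>F\<close>.\<close>

lemma heavier_edge_outside:
  assumes F: "lightest_spanning x n w F" and w: "\<And>e. 0 < w e" and e: "e \<in> F"
  shows "\<exists>e'\<in>{1..n} - F. w e \<le> w e'"
proof -
  obtain D where D: "D \<subseteq> x ` {0..n}" "D \<noteq> {}" "x 0 \<notin> D" "x n \<notin> D" "{e' \<in> F. crosses x D e'} = {e}"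
    using fundamental_cut_exists[OF assms] by auto
  obtain f where f: "f \<in> {1..n}" "f \<noteq> e" "crosses x D f"
    using closed_walk_crosses_twice[OF D(1-4)] by metis
  have "f \<notin> F" using D(5) f by blast
  then show ?thesis using exchange_weight_le[OF F e D(1,3-5) f(1,3)] f(1) by blast
qed

text \<open>Adding the fundamental cut of a crossing edge \<open>e \<in> F\<close> to \<open>A\<close> removes \<open>e\<close> from the crossings and
  does not affect the other edges of \<open>F\<close>. By the exchange property, it does not affect edges lighter than \<open>e\<close>
  either. Repeating this removes all crossings with \<open>F\<close>.\<close>

lemma uncross_cut:
  assumes F: "lightest_spanning x n w F" and w: "\<And>e. 0 < w e"
    and A: "A \<subseteq> x ` {0..n}" "x 0 \<in> A" "x n \<notin> A"
  shows "\<exists>A'. A' \<subseteq> x ` {0..n} \<and> x 0 \<in> A' \<and> x n \<notin> A' \<and> (\<forall>e\<in>F. \<not> crosses x A' e)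
            \<and> (\<forall>f\<in>{1..n}. (\<forall>e\<in>F. crosses x A e \<longrightarrow> w f < w e) \<longrightarrow> crosses x A' f = crosses x A f)"
  using A
proof (induction "card {e \<in> F. crosses x A e}" arbitrary: A rule: less_induct)
  case less
  have fin: "finite F"
    using F by (auto simp: lightest_spanning_def spans_def finite_subset)
  show ?case
  proof (cases "\<forall>e\<in>F. \<not> crosses x A e")
    case True
    then show ?thesis using less.prems by blast
  next
    case False
    then obtain e where e: "e \<in> F" "crosses x A e" by blast
    obtain D where D: "D \<subseteq> x ` {0..n}" "D \<noteq> {}" "x 0 \<notin> D" "x n \<notin> D"
        "{e' \<in> F. crosses x D e'} = {e}"
      using fundamental_cut_exists[OF F w e(1)] by auto
    let ?A = "sym_diff A D"
    have eq: "{e' \<in> F. crosses x ?A e'} = {e' \<in> F. crosses x A e'} - {e}"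
      using D(5) e by (auto simp: crosses_sym_diff)
    have "card ({e' \<in> F. crosses x A e'} - {e}) < card {e' \<in> F. crosses x A e'}"
      by (rule card_Diff1_less) (use fin e in auto)
    then have "card {e' \<in> F. crosses x ?A e'} < card {e' \<in> F. crosses x A e'}" by (simp only: eq)
    moreover have "?A \<subseteq> x ` {0..n}" "x 0 \<in> ?A" "x n \<notin> ?A" using less.prems D by auto
    ultimately obtain A' where A': "A' \<subseteq> x ` {0..n}" "x 0 \<in> A'" "x n \<notin> A'"
        "\<forall>e\<in>F. \<not> crosses x A' e"
        "\<forall>f\<in>{1..n}. (\<forall>e\<in>F. crosses x ?A e \<longrightarrow> w f < w e) \<longrightarrow> crosses x A' f = crosses x ?A f"
      using less.hyps[of ?A] by auto
    have "crosses x A' f = crosses x A f"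
      if f: "f \<in> {1..n}" "\<forall>e\<in>F. crosses x A e \<longrightarrow> w f < w e" for f
    proof -
      have "\<not> crosses x D f"
        using exchange_weight_le[OF F e(1) D(1,3-5) f(1)] f(2) e by force
      moreover have "\<forall>e\<in>F. crosses x ?A e \<longrightarrow> w f < w e" using eq f(2) by blast
      ultimately show ?thesis using A'(5) f(1) by (simp only: crosses_sym_diff) blast
    qed
    then show ?thesis using A' by blast
  qed
qed

text \<open>The set \<open>A\<close> is the component of \<open>x 0\<close> in the forest \<open>F\<close>; it results from uncrossing the singleton
  \<open>{x 0}\<close>.\<close>

lemma separating_cut_exists:
  assumes F: "lightest_spanning x n w F" and w: "\<And>e. 0 < w e" and ne: "x 0 \<noteq> x n"
  shows "\<exists>A. A \<subseteq> x ` {0..n} \<and> x 0 \<in> A \<and> x n \<notin> A \<and> (\<forall>e\<in>F. \<not> crosses x A e)"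
proof -
  have "{x 0} \<subseteq> x ` {0..n}" "x 0 \<in> {x 0}" "x n \<notin> {x 0}" using ne by auto
  from uncross_cut[OF F w this] show ?thesis by blast
qed

text \<open>The bottleneck property of minimum spanning forests: the edges of weight at most \<open>w f\<close> connect the
  two endpoints. In cut form, let \<open>A'\<close> separate the endpoints and suppose that neither \<open>f\<close> nor an edge of
  \<open>F\<close> of weight at most \<open>w f\<close> crosses \<open>A'\<close>. Uncrossing \<open>A'\<close> leads to a set that neither \<open>F\<close> nor \<open>f\<close> crosses.
  There is only one separating set that \<open>F\<close> does not cross, namely \<open>A\<close>, and \<open>f\<close> crosses \<open>A\<close>.

  The distance bound follows since the balls of radius \<open>i * w f\<close> around \<open>x 0\<close> then acquire a new visited point
  in each step until they contain \<open>x n\<close>, and there are at most \<open>n + 1\<close> visited points.\<close>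

lemma separating_edge_long:
  fixes dst :: "'a \<Rightarrow> 'a \<Rightarrow> real"
  assumes F: "lightest_spanning x n w F" and w: "\<And>e. 0 < w e"
    and A: "A \<subseteq> x ` {0..n}" "x 0 \<in> A" "x n \<notin> A" "\<forall>e\<in>F. \<not> crosses x A e"
    and f: "f \<in> {1..n}" "crosses x A f"
    and d0: "dst (x 0) (x 0) = 0"
    and tri: "\<And>p q r. dst p r \<le> dst p q + dst q r"
    and dw: "\<And>e. e \<in> {1..n} \<Longrightarrow> dst (x (e - 1)) (x e) \<le> w e \<and> dst (x e) (x (e - 1)) \<le> w e"
  shows "dst (x 0) (x n) \<le> real n * w f"
proof -
  have sp: "spans x n F" using F by (auto simp: lightest_spanning_def)
  define H where "H = insert f {e \<in> F. w e \<le> w f}"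
  have H: "\<exists>e\<in>H. crosses x A' e" if A': "A' \<subseteq> x ` {0..n}" "x 0 \<in> A'" "x n \<notin> A'" for A'
  proof (rule ccontr)
    assume no: "\<not> ?thesis"
    then have light: "\<forall>e\<in>F. crosses x A' e \<longrightarrow> w f < w e" by (auto simp: H_def not_le)
    obtain A'' where A'': "A'' \<subseteq> x ` {0..n}" "x 0 \<in> A''" "x n \<notin> A''"
        "\<forall>e\<in>F. \<not> crosses x A'' e"
      and pres: "\<forall>f\<in>{1..n}. (\<forall>e\<in>F. crosses x A' e \<longrightarrow> w f < w e) \<longrightarrow> crosses x A'' f = crosses x A' f"
      using uncross_cut[OF F w A'] by blast
    have A''f: "crosses x A'' f = crosses x A' f" using pres f(1) light by blast
    have "sym_diff A A'' = {}"
      by (rule uncrossed_imp_empty[OF sp]) (use A A'' in \<open>auto simp: crosses_sym_diff\<close>)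
    then have "A = A''" by blast
    then show False using A''f f(2) no by (auto simp: H_def)
  qed
  define V where "V i = {v \<in> x ` {0..n}. dst (x 0) v \<le> real i * w f}" for i :: nat
  have finV: "finite (V i)" for i by (simp add: V_def)
  have grow: "i + 1 \<le> card (V i)" if "x n \<notin> V i" for i
    using that
  proof (induction i)
    case 0
    have "x 0 \<in> V 0" by (auto simp: V_def d0)
    then show ?case using finV[of 0] by (metis One_nat_def Suc_leI add_0 card_gt_0_iff empty_iff)
  next
    case (Suc i)
    have mono: "V i \<subseteq> V (Suc i)"
      using w[of f] by (auto simp: V_def algebra_simps)
    then have n: "x n \<notin> V i" using Suc.prems by blast
    have "x 0 \<in> V i" using w[of f] by (auto simp: V_def d0)
    moreover have "V i \<subseteq> x ` {0..n}" by (auto simp: V_def)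
    ultimately obtain e where e: "e \<in> H" "crosses x (V i) e" using H[of "V i"] n by blast
    have "F \<subseteq> {1..n}" using sp by (simp add: spans_def)
    then have e1: "e \<in> {1..n}" "w e \<le> w f" using e(1) f(1) by (auto simp: H_def)
    then have *: "dst (x (e - 1)) (x e) \<le> w f" "dst (x e) (x (e - 1)) \<le> w f" using dw[of e] by auto
    have "x (e - 1) \<in> V (Suc i) \<and> x e \<in> V (Suc i)"
    proof -
      have "x (e-1) \<in> x ` {0..n}" "x e \<in> x ` {0..n}" using e1 by auto
      then show ?thesis
        using * tri[of "x 0" "x e" "x (e-1)"] tri[of "x 0" "x (e-1)" "x e"] e(2)
        by (auto simp: V_def crosses_def algebra_simps)
    qed
    then have "V i \<subset> V (Suc i)" using mono e(2) by (auto simp: crosses_def)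
    then have "card (V i) < card (V (Suc i))" using finV by (intro psubset_card_mono)
    then show ?case using Suc.IH n by simp
  qed
  have "x n \<in> V n"
  proof (rule ccontr)
    assume no: "x n \<notin> V n"
    then have "n + 1 \<le> card (V n)" by (rule grow)
    also have "card (V n) < card (x ` {0..n})"
      by (rule psubset_card_mono) (use no in \<open>auto simp: V_def\<close>)
    also have "\<dots> \<le> n + 1" using card_image_le[of "{0..n}" x] by simp
    finally show False by simp
  qed
  then show ?thesis by (simp add: V_def)
qed

section \<open>Weights of irreducible paths\<close>

text \<open>The factors \<open>w e powr (\<epsilon> / n)\<close> that turn \<open>- d - \<epsilon> / n\<close> back into \<open>- d\<close> on \<open>F\<close> are paid for by the heaviest
  edge \<open>a\<close> outside \<open>F\<close>, which dominates every edge. It has weight at least \<open>l\<close>, so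
  \<open>w a powr (\<epsilon> - d) \<le> l powr (\<epsilon> - d)\<close> as \<open>\<epsilon> \<le> d\<close>. Two further edges of \<open>S\<close> give \<open>l powr (- 2 * d)\<close>.\<close>

lemma prod_weights_le:
  fixes w :: "nat \<Rightarrow> real"
  assumes fin: "finite E" and FE: "F \<subseteq> E" and w: "\<And>e. 1 \<le> w e" and l: "0 < l"
    and S: "S \<subseteq> E - F" "3 \<le> card S" "\<And>f. f \<in> S \<Longrightarrow> l \<le> w f"
    and out: "\<And>e. e \<in> F \<Longrightarrow> \<exists>e'\<in>E - F. w e \<le> w e'"
    and k: "card F \<le> n" "0 < n" and eps: "0 < \<epsilon>" "\<epsilon> \<le> d"
  shows "(\<Prod>e\<in>E. w e powr - d)
     \<le> l powr (- 3 * d + \<epsilon>) * (\<Prod>e\<in>F. w e powr (- d - \<epsilon> / n))"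
proof -
  have pos: "0 < w e" for e using w[of e] by simp
  have d: "0 < d" using eps by simp
  have finN: "finite (E - F)" and finF: "finite F" and finS: "finite S"
    using fin FE S(1) by (auto intro: finite_subset)
  have "S \<noteq> {}" using S(2) by auto
  then have "E - F \<noteq> {}" using S(1) by blast
  then have "Max (w ` (E - F)) \<in> w ` (E - F)" using finN by (intro Max_in) auto
  then obtain a where a0: "a \<in> E - F" "w a = Max (w ` (E - F))" by force
  have a: "a \<in> E - F" "\<And>e. e \<in> E - F \<Longrightarrow> w e \<le> w a"
    using a0 finN by simp_all
  have aF: "w e \<le> w a" if "e \<in> F" for e using out[OF that] a(2) by force
  have la: "l \<le> w a" using S(1) S(3) a(2) \<open>S \<noteq> {}\<close> by force
  have "2 \<le> card (S - {a})" using S(2) finS by (cases "a \<in> S") (auto simp: card_Diff_singleton)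
  then obtain T where T: "T \<subseteq> S - {a}" "card T = 2" by (meson obtain_subset_with_card_n)
  then obtain b c where bc: "T = {b, c}" "b \<noteq> c" by (meson card_2_iff)
  have bcS: "b \<in> S" "c \<in> S" "b \<noteq> a" "c \<noteq> a" using T(1) bc by auto
  have le1: "w e powr - d \<le> 1" for e using powr_mono2'[of "- d" 1 "w e"] w[of e] d by simp
  have "(\<Prod>e\<in>E - F. w e powr - d)
      = (\<Prod>e\<in>{a, b, c}. w e powr - d) * (\<Prod>e\<in>E - F - {a, b, c}. w e powr - d)"
    using prod.subset_diff[of "{a,b,c}" "E - F" "\<lambda>e. w e powr - d"] finN a(1) bcS S(1)
    by (simp add: mult.commute subset_iff)
  also have "\<dots> \<le> (\<Prod>e\<in>{a, b, c}. w e powr - d) * 1"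
    by (intro mult_left_mono prod_le_1 prod_nonneg) (use le1 in auto)
  also have "\<dots> = w a powr - d * (w b powr - d * w c powr - d)" using bc(2) bcS by auto
  also have "\<dots> \<le> w a powr - d * (l powr - d * l powr - d)"
    by (intro mult_left_mono mult_mono powr_mono2') (use l d S(3) bcS in auto)
  finally have N: "(\<Prod>e\<in>E - F. w e powr - d) \<le> w a powr - d * (l powr - d * l powr - d)" .
  have "(\<Prod>e\<in>F. w e powr (\<epsilon> / n)) \<le> (\<Prod>e\<in>F. w a powr (\<epsilon> / n))"
    by (intro prod_mono conjI powr_mono2) (use eps pos aF in \<open>auto intro: less_imp_le\<close>)
  also have "\<dots> = w a powr (\<epsilon> * (card F / n))"
    using pos[of a] by (simp add: powr_power mult.commute)
  also have "\<dots> \<le> w a powr \<epsilon>"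
    using k eps w[of a] by (intro powr_mono) (auto simp: field_simps)
  finally have F: "(\<Prod>e\<in>F. w e powr (\<epsilon> / n)) \<le> w a powr \<epsilon>" .
  let ?F = "\<Prod>e\<in>F. w e powr (- d - \<epsilon> / n)"
  have "(\<Prod>e\<in>E. w e powr - d) = (\<Prod>e\<in>E - F. w e powr - d) * (\<Prod>e\<in>F. w e powr - d)"
    using prod.subset_diff[OF FE fin] by blast
  also have "(\<Prod>e\<in>F. w e powr - d) = (\<Prod>e\<in>F. w e powr (\<epsilon> / n)) * ?F"
    by (simp add: prod.distrib [symmetric] powr_add [symmetric])
  also have "(\<Prod>e\<in>E - F. w e powr - d) * ((\<Prod>e\<in>F. w e powr (\<epsilon> / n)) * ?F)
      \<le> (w a powr - d * (l powr - d * l powr - d)) * (w a powr \<epsilon> * ?F)"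
    by (intro mult_mono N F prod_nonneg mult_nonneg_nonneg order_refl) auto
  also have "\<dots> = w a powr (\<epsilon> - d) * (l powr - d * l powr - d) * ?F"
    by (simp add: powr_add [symmetric] algebra_simps)
  also have "\<dots> \<le> l powr (\<epsilon> - d) * (l powr - d * l powr - d) * ?F"
    using powr_mono2'[of "\<epsilon> - d" l "w a"] eps l la
    by (intro mult_right_mono mult_nonneg_nonneg prod_nonneg) auto
  also have "\<dots> = l powr (- 3 * d + \<epsilon>) * ?F" by (simp add: powr_add [symmetric] algebra_simps)
  finally show ?thesis .
qed

text \<open>Paths with the same pattern of coincidences are determined by their increments along \<open>F\<close>. Indeed, if two of
  them have equal increments, then the set of points at which they differ is well defined by the common pattern,
  is not crossed by \<open>F\<close> and avoids the endpoints, so it is empty as \<open>F\<close> spans.\<close>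

lemma sum_over_equal_pattern_le:
  fixes \<phi> :: "'a::ab_group_add \<Rightarrow> real"
  assumes X: "finite X" "X \<subseteq> paths n"
    and pat: "\<And>y y' i j. y \<in> X \<Longrightarrow> y' \<in> X \<Longrightarrow> i \<le> n \<Longrightarrow> j \<le> n \<Longrightarrow>
       vertex n a b y i = vertex n a b y j \<longleftrightarrow> vertex n a b y' i = vertex n a b y' j"
    and sp: "\<And>y. y \<in> X \<Longrightarrow> spans (vertex n a b y) n F" and FE: "F \<subseteq> {1..n}" and n: "0 < n"
    and \<phi>: "\<And>z. 0 \<le> \<phi> z" "\<And>Z. finite Z \<Longrightarrow> sum \<phi> Z \<le> S"
  shows "(\<Sum>y\<in>X. \<Prod>e\<in>F. \<phi> (vertex n a b y (e - 1) - vertex n a b y e)) \<le> S ^ card F"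
proof -
  define G where "G y = restrict (\<lambda>e. vertex n a b y (e - 1) - vertex n a b y e) F" for y
  have finF: "finite F" using FE by (rule finite_subset) simp
  have inj: "inj_on G X"
  proof (rule inj_onI)
    fix y y' assume y: "y \<in> X" "y' \<in> X" and eq: "G y = G y'"
    let ?v = "vertex n a b y" and ?v' = "vertex n a b y'"
    define D where "D = {?v j |j. j \<le> n \<and> ?v j \<noteq> ?v' j}"
    have D: "?v j \<in> D \<longleftrightarrow> ?v j \<noteq> ?v' j" if "j \<le> n" for j
      using that pat[OF y] unfolding D_def by (smt (verit) mem_Collect_eq)
    have "D = {}"
    proof (rule uncrossed_imp_empty[OF sp[OF y(1)]])
      show "D \<subseteq> ?v ` {0..n}" by (auto simp: D_def)
      show "?v 0 \<notin> D" "?v n \<notin> D" using D[of 0] D[of n] n by (simp_all add: vertex_def)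
      show "\<forall>e\<in>F. \<not> crosses ?v D e"
      proof
        fix e assume e: "e \<in> F"
        have "?v (e - 1) - ?v e = ?v' (e - 1) - ?v' e"
          using fun_cong[OF eq, of e] e by (simp add: G_def)
        moreover have en: "e \<le> n" using e FE by auto
        moreover have "e - 1 \<le> n" using en by simp
        moreover have "p = p' \<longleftrightarrow> q = q'" if "p - q = p' - q'" for p q p' q' :: 'a
          using that by (metis add_diff_cancel_left' diff_add_cancel)
        ultimately show "\<not> crosses ?v D e" unfolding crosses_def using D by blast
      qed
    qed
    then have same: "?v j = ?v' j" if "j \<le> n" for j using D[OF that] by blast
    have "y j = y' j" if "j \<in> {1..<n}" for j using same[of j] that by (simp add: vertex_def)
    moreover have "y \<in> {1..<n} \<rightarrow>\<^sub>E UNIV" "y' \<in> {1..<n} \<rightarrow>\<^sub>E UNIV"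
      using y X(2) by (auto simp: paths_def)
    ultimately show "y = y'" by (metis PiE_ext)
  qed
  define Z where "Z = (\<lambda>(y, e). G y e) ` (X \<times> F)"
  have finZ: "finite Z" using X finF by (auto simp: Z_def)
  have "G y \<in> F \<rightarrow>\<^sub>E Z" if "y \<in> X" for y
  proof (rule PiE_I)
    show "G y e \<in> Z" if "e \<in> F" for e
      unfolding Z_def using \<open>y \<in> X\<close> that by (intro image_eqI[of _ _ "(y, e)"]) auto
  qed (simp add: G_def)
  then have sub: "G ` X \<subseteq> F \<rightarrow>\<^sub>E Z" by blast
  have "(\<Sum>y\<in>X. \<Prod>e\<in>F. \<phi> (vertex n a b y (e - 1) - vertex n a b y e))
     = (\<Sum>y\<in>X. \<Prod>e\<in>F. \<phi> (G y e))" by (simp add: G_def)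
  also have "\<dots> = (\<Sum>g\<in>G ` X. \<Prod>e\<in>F. \<phi> (g e))" by (simp add: sum.reindex[OF inj])
  also have "\<dots> \<le> (\<Sum>g\<in>F \<rightarrow>\<^sub>E Z. \<Prod>e\<in>F. \<phi> (g e))"
    by (rule sum_mono2) (use sub finZ finF \<phi>(1) in \<open>auto intro: finite_PiE prod_nonneg\<close>)
  also have "\<dots> = (\<Prod>e\<in>F. sum \<phi> Z)" by (rule prod_sum_PiE[symmetric]) (use finF finZ in auto)
  also have "\<dots> \<le> (\<Prod>e\<in>F. S)" by (intro prod_mono) (use \<phi> finZ in \<open>auto intro: sum_nonneg\<close>)
  finally show ?thesis by simp
qed

text \<open>The endpoints must lie at distance at most \<open>n * w f\<close> for each of the three edges \<open>f\<close> across the cut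
  between the two components of \<open>F\<close>; since the bracket adds 1 to the distance, the divisor becomes \<open>n + 1\<close>.\<close>

lemma irreducible_path_weight_bound:
  fixes x :: "nat \<Rightarrow> int ^ 'd::finite"
  assumes irr: "\<forall>j<n. x ` {0..j} \<inter> x ` {Suc j..n} \<noteq> {}" and ne: "x 0 \<noteq> x n"
    and eps: "0 < \<epsilon>" "\<epsilon> < 1"
  defines "w \<equiv> \<lambda>e. bracket (x (e - 1) - x e)"
  shows "\<exists>F. spans x n F \<and> card F + 3 \<le> n \<and>
    (\<Prod>e\<in>{1..n}. w e powr - real CARD('d))
      \<le> (bracket (x 0 - x n) / (real n + 1)) powr (- 3 * real CARD('d) + \<epsilon>)
         * (\<Prod>e\<in>F. w e powr (- real CARD('d) - \<epsilon> / n))"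
proof -
  obtain F where F: "lightest_spanning x n w F" using ex_lightest_spanning by blast
  have w1: "1 \<le> w e" for e by (simp add: w_def bracket_ge_1)
  have w0: "0 < w e" for e using w1[of e] by simp
  have sp: "spans x n F" and FE: "F \<subseteq> {1..n}" using F by (auto simp: lightest_spanning_def spans_def)
  obtain A where A: "A \<subseteq> x ` {0..n}" "x 0 \<in> A" "x n \<notin> A" "\<forall>e\<in>F. \<not> crosses x A e"
    using separating_cut_exists[of x n w F, OF F w0 ne] by blast
  define S where "S = {j \<in> {1..n}. crosses x A j}"
  have S3: "3 \<le> card S" unfolding S_def by (rule irreducible_crosses_thrice[OF irr A(2,3)])
  have SF: "S \<subseteq> {1..n} - F" using A(4) by (auto simp: S_def)
  have n: "0 < n" using ne by (auto intro: gr0I)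
  have "card F + card S = card (F \<union> S)"
    using SF FE by (intro card_Un_disjoint[symmetric]) (auto intro: finite_subset)
  also have "\<dots> \<le> card {1..n}" using SF FE by (intro card_mono) auto
  finally have card: "card F + 3 \<le> n" using S3 by simp
  let ?l = "bracket (x 0 - x n) / (real n + 1)"
  have long: "?l \<le> w f" if f: "f \<in> S" for f
  proof -
    define dst where "dst p q = norm (real_vec (p - q))" for p q :: "int ^ 'd"
    have rv: "real_vec (p - q) = real_vec p - real_vec q" for p q :: "int ^ 'd"
      by (simp add: real_vec_def vec_eq_iff)
    have "dst (x 0) (x n) \<le> real n * w f"
    proof (rule separating_edge_long[OF F w0 A])
      show "f \<in> {1..n}" "crosses x A f" using f by (auto simp: S_def)
      show "dst (x 0) (x 0) = 0" by (simp add: dst_def real_vec_def vec_eq_iff)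
      show "dst p r \<le> dst p q + dst q r" for p q r
        using norm_triangle_ineq[of "real_vec (p - q)" "real_vec (q - r)"] by (simp add: dst_def rv)
      show "dst (x (e - 1)) (x e) \<le> w e \<and> dst (x e) (x (e - 1)) \<le> w e" for e
        by (simp add: dst_def w_def bracket_def rv norm_minus_commute)
    qed
    then have "bracket (x 0 - x n) \<le> (real n + 1) * w f"
      using w1[of f] by (simp add: bracket_def dst_def algebra_simps)
    then show ?thesis by (simp add: pos_divide_le_eq mult.commute)
  qed
  have "(\<Prod>e\<in>{1..n}. w e powr - real CARD('d))
      \<le> ?l powr (- 3 * real CARD('d) + \<epsilon>) * (\<Prod>e\<in>F. w e powr (- real CARD('d) - \<epsilon> / n))"
  proof (rule prod_weights_le[OF _ FE w1 _ SF S3 long])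
    show "0 < ?l" using bracket_ge_1[of "x 0 - x n"] by simp
    show "\<exists>e'\<in>{1..n} - F. w e \<le> w e'" if "e \<in> F" for e
      by (rule heavier_edge_outside[OF F w0 that])
    have "1 \<le> real CARD('d)" by (simp add: Suc_leI)
    then show "\<epsilon> \<le> real CARD('d)" using eps by linarith
  qed (use card n eps in simp_all)
  then show ?thesis using sp card by (intro exI[of _ F] conjI)
qed

text \<open>The map \<open>\<rho> y\<close> sends an index to the first index with the same vertex and thus encodes the pattern of
  coincidences by one of \<open>(n + 1) ^ (n + 1)\<close> functions.\<close>

lemma irreducible_sum_bound:
  fixes a b :: "int ^ 'd::finite"
  assumes n: "3 \<le> n" and ne: "a \<noteq> b" and eps: "0 < \<epsilon>" "\<epsilon> < 1"
    and X: "finite X" "X \<subseteq> irreducible_paths n a b"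
  shows "(\<Sum>y\<in>X. \<Prod>e\<in>{1..n}. bracket (vertex n a b y (e - 1) - vertex n a b y e) powr - real CARD('d))
    \<le> real ((n + 1) ^ (n + 1) * 2 ^ n)
       * (bracket (a - b) / (real n + 1)) powr (- 3 * real CARD('d) + \<epsilon>)
       * (3 * 5 ^ CARD('d) * real n / \<epsilon>) ^ (n - 3)"
proof -
  let ?v = "vertex n a b"
  let ?w = "\<lambda>y e. bracket (?v y (e - 1) - ?v y e)"
  let ?d = "real CARD('d)"
  let ?L = "(bracket (a - b) / (real n + 1)) powr (- 3 * ?d + \<epsilon>)"
  let ?S = "3 * 5 ^ CARD('d) * real n / \<epsilon>"
  let ?\<phi> = "\<lambda>z :: int ^ 'd. bracket z powr (- ?d - \<epsilon> / n)"
  have v0: "?v y 0 = a" "?v y n = b" for y using n by (simp_all add: vertex_def)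
  define good where "good y F \<longleftrightarrow> spans (?v y) n F \<and> card F + 3 \<le> n \<and>
     (\<Prod>e\<in>{1..n}. ?w y e powr - ?d) \<le> ?L * (\<Prod>e\<in>F. ?\<phi> (?v y (e - 1) - ?v y e))" for y F
  define F where "F y = (SOME F. good y F)" for y
  have good: "good y (F y)" if "y \<in> X" for y
  proof -
    have "\<forall>j<n. ?v y ` {0..j} \<inter> ?v y ` {Suc j..n} \<noteq> {}"
      using that X(2) by (auto simp only: irreducible_paths_def subset_iff mem_Collect_eq)
    moreover have "?v y 0 \<noteq> ?v y n" using ne by (simp only: v0 not_False_eq_True)
    ultimately have "\<exists>F. good y F"
      unfolding good_def using irreducible_path_weight_bound[of n "?v y" \<epsilon>, unfolded v0] eps ne by blast
    then show ?thesis unfolding F_def by (rule someI_ex)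
  qed
  have F: "spans (?v y) n (F y)" "card (F y) + 3 \<le> n"
     "(\<Prod>e\<in>{1..n}. ?w y e powr - ?d) \<le> ?L * (\<Prod>e\<in>F y. ?\<phi> (?v y (e - 1) - ?v y e))"
    if "y \<in> X" for y
    using good[OF that] unfolding good_def by blast+
  define \<rho> where "\<rho> y = restrict (\<lambda>j. LEAST i. ?v y i = ?v y j) {0..n}" for y
  have \<rho>_in: "\<rho> y \<in> {0..n} \<rightarrow>\<^sub>E {0..n}" for y
  proof (rule PiE_I)
    fix j assume "j \<in> {0..n}"
    then show "\<rho> y j \<in> {0..n}" using Least_le[of "\<lambda>i. ?v y i = ?v y j" j] by (auto simp: \<rho>_def)
  qed (simp add: \<rho>_def)
  have \<rho>_eq: "?v y i = ?v y j \<longleftrightarrow> \<rho> y i = \<rho> y j" if "i \<le> n" "j \<le> n" for y i j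
  proof
    assume "\<rho> y i = \<rho> y j"
    then have eq: "(LEAST k. ?v y k = ?v y i) = (LEAST k. ?v y k = ?v y j)" using that by (simp add: \<rho>_def)
    have "?v y (LEAST k. ?v y k = ?v y l) = ?v y l" for l by (rule LeastI[of _ l]) (rule refl)
    from this[of i, symmetric] show "?v y i = ?v y j" unfolding eq by (rule trans) fact
  qed (use that in \<open>simp add: \<rho>_def\<close>)
  define Cert where "Cert = ({0..n} \<rightarrow>\<^sub>E {0..n}) \<times> Pow {1..n}"
  have finC: "finite Cert" unfolding Cert_def by (intro finite_SigmaI finite_PiE) auto
  have cardC: "card Cert = (n + 1) ^ (n + 1) * 2 ^ n"
    by (simp add: Cert_def card_cartesian_product card_PiE card_Pow)
  have S1: "1 \<le> ?S"
  proof -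
    have "(1::real) \<le> 5 ^ CARD('d)" by simp
    then have "(1::real) \<le> 3 * 5 ^ CARD('d)" by linarith
    then have "1 * 1 \<le> (3 * 5 ^ CARD('d)) * real n" using n by (intro mult_mono) auto
    then show ?thesis using eps by (simp add: pos_le_divide_eq)
  qed
  have L0: "0 \<le> ?L" by simp
  have per_certificate: "(\<Sum>y\<in>{y \<in> X. (\<rho> y, F y) = c}. \<Prod>e\<in>{1..n}. ?w y e powr - ?d) \<le> ?L * ?S ^ (n - 3)" for c
  proof (cases "{y \<in> X. (\<rho> y, F y) = c} = {}")
    case True
    have "0 \<le> ?L * ?S ^ (n - 3)" using S1 by (intro mult_nonneg_nonneg zero_le_power) auto
    then show ?thesis using True by (simp only: sum.empty)
  next
    case False
    obtain r G where c: "c = (r, G)" by (cases c)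
    let ?X = "{y \<in> X. (\<rho> y, F y) = c}"
    have G: "G \<subseteq> {1..n}" "card G \<le> n - 3"
      using False F(1,2) by (force simp: c spans_def)+
    have "(\<Sum>y\<in>?X. \<Prod>e\<in>{1..n}. ?w y e powr - ?d)
        \<le> (\<Sum>y\<in>?X. ?L * (\<Prod>e\<in>G. ?\<phi> (?v y (e - 1) - ?v y e)))"
      by (intro sum_mono) (use F(3) in \<open>auto simp: c\<close>)
    also have "\<dots> = ?L * (\<Sum>y\<in>?X. \<Prod>e\<in>G. ?\<phi> (?v y (e - 1) - ?v y e))"
      by (simp add: sum_distrib_left)
    also have "\<dots> \<le> ?L * ?S ^ card G"
    proof (intro mult_left_mono[OF _ L0] sum_over_equal_pattern_le)
      show "finite ?X" using X(1) by simp
      show "?X \<subseteq> paths n" using X(2) by (auto simp: irreducible_paths_def)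
      show "(?v y i = ?v y j) = (?v y' i = ?v y' j)"
        if "y \<in> ?X" "y' \<in> ?X" "i \<le> n" "j \<le> n" for y y' i j
        using that \<rho>_eq[OF that(3,4), of y] \<rho>_eq[OF that(3,4), of y'] by (simp add: c)
      show "spans (?v y) n G" if "y \<in> ?X" for y using that F(1) by (auto simp: c)
      show "G \<subseteq> {1..n}" by (rule G(1))
      show "0 < n" using n by simp
      show "sum ?\<phi> Z \<le> ?S" if "finite Z" for Z
        using lattice_sum_le[of "\<epsilon> / n" Z] that eps n by simp
    qed simp
    also have "\<dots> \<le> ?L * ?S ^ (n - 3)"
      by (intro mult_left_mono[OF _ L0] power_increasing G(2) S1)
    finally show ?thesis .
  qed
  have "(\<Sum>y\<in>X. \<Prod>e\<in>{1..n}. ?w y e powr - ?d)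
     = (\<Sum>c\<in>Cert. \<Sum>y\<in>{y \<in> X. (\<rho> y, F y) = c}. \<Prod>e\<in>{1..n}. ?w y e powr - ?d)"
  proof (rule sum.group[symmetric, OF X(1) finC])
    have "F y \<subseteq> {1..n}" if "y \<in> X" for y using F(1)[OF that] unfolding spans_def by blast
    then show "(\<lambda>y. (\<rho> y, F y)) ` X \<subseteq> Cert" using \<rho>_in unfolding Cert_def by blast
  qed
  also have "\<dots> \<le> (\<Sum>c\<in>Cert. ?L * ?S ^ (n - 3))" by (intro sum_mono per_certificate)
  also have "\<dots> = real (card Cert) * (?L * ?S ^ (n - 3))" by simp
  finally show ?thesis by (simp only: cardC mult.assoc)
qed

section \<open>The path sum\<close>

lemma norm_path_weight_le:
  fixes a b :: "int ^ 'd::finite"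
  assumes K: "\<And>j. j \<in> {1..n} \<Longrightarrow> \<forall>x. norm (conv_kernel (K j) x) \<le> M * bracket x powr - real CARD('d)"
    and c: "\<And>j y. j \<in> {1..n} \<Longrightarrow> norm (c j y) \<le> B"
    and M: "0 \<le> M"
  shows "norm (path_weight K c n a b y)
      \<le> (M * B) ^ n * (\<Prod>e\<in>{1..n}. bracket (vertex n a b y (e - 1) - vertex n a b y e) powr - real CARD('d))"
proof -
  let ?w = "\<lambda>e. bracket (vertex n a b y (e - 1) - vertex n a b y e) powr - real CARD('d)"
  have "norm (path_weight K c n a b y) \<le> (\<Prod>e\<in>{1..n}. (M * B) * ?w e)"
    unfolding path_weight_def prod_norm [symmetric]
  proof (intro prod_mono conjI norm_ge_zero)
    fix e assume e: "e \<in> {1..n}"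
    let ?v = "vertex n a b y"
    have "norm (weighted_kernel (K e) (c e) (?v (e - 1)) (?v e))
        = norm (conv_kernel (K e) (?v (e - 1) - ?v e)) * norm (c e (?v e))"
      by (simp add: weighted_kernel_def norm_mult)
    also have "\<dots> \<le> (M * ?w e) * B"
      by (intro mult_mono) (use K[OF e] c[OF e] M in auto)
    finally show "norm (weighted_kernel (K e) (c e) (?v (e - 1)) (?v e)) \<le> (M * B) * ?w e"
      by (simp add: ac_simps)
  qed
  also have "\<dots> = (M * B) ^ n * (\<Prod>e\<in>{1..n}. ?w e)" by (simp add: prod.distrib)
  finally show ?thesis .
qed

text \<open>Everything that is exponential in \<open>n\<close> or a fixed power of \<open>n ^ n\<close> fits into \<open>C powr (n ln n)\<close>, because
  \<open>ln n \<ge> 1\<close> for \<open>n \<ge> 3\<close>.\<close>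

lemma combinatorial_factor_le:
  fixes c q :: real
  assumes c: "1 \<le> c" and q: "1 \<le> q" and n: "3 \<le> n"
  shows "c ^ n * real ((n + 1) ^ (n + 1) * 2 ^ n) * (real n + 1) ^ (3 * d) * (q * real n) ^ (n - 3)
     \<le> (2 * c * q * exp (real (5 + 6 * d))) powr (real n * ln (real n))"
proof -
  let ?n = "real n" and ?L = "real n * ln (real n)"
  let ?Q = "2 * c * q"
  have n1: "1 \<le> ?n" using n by simp
  have cq: "1 * 1 \<le> c * q" by (rule mult_mono) (use c q in auto)
  then have Q: "1 \<le> ?Q" by simp
  have "exp 1 \<le> ?n" using exp_le n by linarith
  then have ln1: "1 \<le> ln ?n" using n by (subst ln_ge_iff) auto
  have n_pow: "?n ^ (k * n) = exp (real k * ?L)" for k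
  proof -
    have "?n ^ (k * n) = ?n powr real (k * n)" using n by (subst powr_realpow) auto
    then show ?thesis using n by (simp add: powr_def ac_simps)
  qed
  have "?n * 3 \<le> ?n * ?n" using n by (intro mult_left_mono) auto
  moreover have "?n + 1 \<le> ?n * 3" using n by simp
  ultimately have "?n + 1 \<le> ?n ^ 2" unfolding power2_eq_square by linarith
  then have "(?n + 1) ^ (n + 1 + 3 * d) \<le> (?n ^ 2) ^ (n + 1 + 3 * d)" by (intro power_mono) auto
  also have "\<dots> = ?n ^ (2 * (n + 1 + 3 * d))" by (simp only: power_mult)
  also have "\<dots> \<le> ?n ^ ((4 + 6 * d) * n)"
  proof (rule power_increasing[OF _ n1])
    have le: "2 * (n + 1 + 3 * d) \<le> 4 * n + 6 * p" if "d \<le> p" for p :: nat using that n by presburger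
    have "(4 + 6 * d) * n = 4 * n + 6 * (d * n)" by (simp add: algebra_simps)
    then show "2 * (n + 1 + 3 * d) \<le> (4 + 6 * d) * n" using le[of "d * n"] n by simp
  qed
  finally have 1: "(?n + 1) ^ (n + 1 + 3 * d) \<le> ?n ^ ((4 + 6 * d) * n)" .
  have "1 * 1 \<le> q * ?n" by (rule mult_mono) (use q n1 in auto)
  then have "(q * ?n) ^ (n - 3) \<le> (q * ?n) ^ n" by (intro power_increasing) auto
  then have 2: "(q * ?n) ^ (n - 3) \<le> q ^ n * ?n ^ (1 * n)" by (simp add: power_mult_distrib)
  have "?Q ^ n = ?Q powr (?n * 1)" using Q by (simp add: powr_realpow)
  also have "\<dots> \<le> ?Q powr ?L"
    by (intro powr_mono mult_left_mono) (use ln1 Q in auto)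
  finally have 3: "?Q ^ n \<le> ?Q powr ?L" .
  have "c ^ n * real ((n + 1) ^ (n + 1) * 2 ^ n) * (?n + 1) ^ (3 * d) * (q * ?n) ^ (n - 3)
      = (c ^ n * 2 ^ n) * ((?n + 1) ^ (n + 1 + 3 * d) * (q * ?n) ^ (n - 3))"
    unfolding power_add[of _ "n + 1" "3 * d"] of_nat_mult of_nat_power of_nat_add of_nat_1 of_nat_numeral
    by (simp only: ac_simps)
  also have "\<dots> \<le> (c ^ n * 2 ^ n) * (?n ^ ((4 + 6 * d) * n) * (q ^ n * ?n ^ (1 * n)))"
    by (intro mult_left_mono mult_mono 1 2) (use c q in auto)
  also have "\<dots> = ?Q ^ n * (exp (real (4 + 6 * d) * ?L) * exp (real 1 * ?L))"
    unfolding n_pow by (simp add: power_mult_distrib ac_simps)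
  also have "exp (real (4 + 6 * d) * ?L) * exp (real 1 * ?L) = exp (real (5 + 6 * d)) powr ?L"
    by (simp add: powr_def exp_add [symmetric] algebra_simps)
  also have "?Q ^ n * exp (real (5 + 6 * d)) powr ?L \<le> ?Q powr ?L * exp (real (5 + 6 * d)) powr ?L"
    by (intro mult_right_mono 3) simp
  also have "\<dots> = (?Q * exp (real (5 + 6 * d))) powr ?L"
    using Q by (simp add: powr_mult)
  finally show ?thesis .
qed

theorem theorem1p8:
  fixes Calpha :: "('d::finite \<Rightarrow> nat) \<Rightarrow> real" and B :: real
  shows "\<exists>C>1. \<exists>\<epsilon>0>0.
    \<forall>(n::nat) (x0 :: int ^ 'd) (xn :: int ^ 'd)
      (K :: nat \<Rightarrow> (int ^ 'd \<Rightarrow> complex) \<Rightarrow> int ^ 'd \<Rightarrow> complex)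
      (b :: nat \<Rightarrow> int ^ 'd \<Rightarrow> complex).
      3 \<le> n \<longrightarrow> x0 \<noteq> xn \<longrightarrow>
      (\<forall>j\<in>{1..n}. singular_integral_operator Calpha (K j)) \<longrightarrow>
      (\<forall>j\<in>{1..n}. \<forall>y. norm (b j y) \<le> B) \<longrightarrow>
      (\<lambda>x. norm (path_weight K b n x0 xn x)) summable_on irreducible_paths n x0 xn \<and>
      (\<forall>\<epsilon>. 0 < \<epsilon> \<and> \<epsilon> < \<epsilon>0 \<longrightarrow>
        norm (path_sum K b n (irreducible_paths n x0 xn) x0 xn)
          \<le> C powr (real n * ln (real n)) * \<epsilon> powr (3 - real n)
              * bracket (x0 - xn) powr (- 3 * real CARD('d) + \<epsilon>))"
proof -
  let ?d = "CARD('d)"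
  obtain M where M: "1 \<le> M" and decay: "\<And>K x. singular_integral_operator Calpha K \<Longrightarrow>
            norm (conv_kernel K x) \<le> M * bracket x powr - real ?d"
    using singular_kernel_decay[of Calpha] by blast
  define c where "c = M * max 1 B"
  define q where "q = (3 * 5 ^ ?d :: real)"
  define C where "C = 2 * c * q * exp (real (5 + 6 * ?d))"
  have "1 * 1 \<le> c" unfolding c_def by (rule mult_mono) (use M in auto)
  then have c: "1 \<le> c" by simp
  have "(1::real) \<le> 5 ^ ?d" by simp
  then have q: "1 \<le> q" unfolding q_def by linarith
  have "1 * 1 \<le> c * q" by (rule mult_mono) (use c q in auto)
  then have "1 * 1 < (2 * (c * q)) * exp (real (5 + 6 * ?d))"
    by (intro mult_less_le_imp_less) auto
  then have C: "1 < C" by (simp add: C_def mult.assoc)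
  have main: "(\<lambda>x. norm (path_weight K b n x0 xn x)) summable_on irreducible_paths n x0 xn \<and>
      (\<forall>\<epsilon>. 0 < \<epsilon> \<and> \<epsilon> < 1 \<longrightarrow>
        norm (path_sum K b n (irreducible_paths n x0 xn) x0 xn)
          \<le> C powr (real n * ln (real n)) * \<epsilon> powr (3 - real n)
              * bracket (x0 - xn) powr (- 3 * real ?d + \<epsilon>))"
    if n: "3 \<le> n" and ne: "x0 \<noteq> xn"
      and K: "\<forall>j\<in>{1..n}. singular_integral_operator Calpha (K j)"
      and b: "\<forall>j\<in>{1..n}. \<forall>y. norm (b j y) \<le> B"
    for n and x0 xn :: "int ^ 'd" and K b
  proof -
    let ?U = "irreducible_paths n x0 xn"
    let ?f = "\<lambda>x. norm (path_weight K b n x0 xn x)"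
    let ?R = "\<lambda>\<epsilon>. C powr (real n * ln (real n)) * \<epsilon> powr (3 - real n)
              * bracket (x0 - xn) powr (- 3 * real ?d + \<epsilon>)"
    have fin_sum: "sum ?f X \<le> ?R \<epsilon>"
      if X: "finite X" "X \<subseteq> ?U" and eps: "0 < \<epsilon>" "\<epsilon> < 1" for X \<epsilon>
    proof -
      let ?w = "\<lambda>y. \<Prod>e\<in>{1..n}. bracket (vertex n x0 xn y (e - 1) - vertex n x0 xn y e) powr - real ?d"
      let ?p = "- 3 * real ?d + \<epsilon>"
      have "?f y \<le> c ^ n * ?w y" for y
        unfolding c_def
        by (rule norm_path_weight_le) (use K b decay M in \<open>auto simp: le_max_iff_disj\<close>)
      then have "sum ?f X \<le> c ^ n * sum ?w X"
        by (simp add: sum_distrib_left sum_mono)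
      also have "\<dots> \<le> c ^ n * (real ((n + 1) ^ (n + 1) * 2 ^ n)
          * (bracket (x0 - xn) / (real n + 1)) powr ?p * (q * real n / \<epsilon>) ^ (n - 3))"
        unfolding q_def
        by (intro mult_left_mono irreducible_sum_bound[OF n ne eps X]) (use c in simp)
      also have "(bracket (x0 - xn) / (real n + 1)) powr ?p
          = bracket (x0 - xn) powr ?p * (real n + 1) powr (- ?p)"
        
        by (simp only: powr_divide) (simp only: powr_minus divide_inverse)
      also have "(q * real n / \<epsilon>) ^ (n - 3) = (q * real n) ^ (n - 3) * \<epsilon> powr (3 - real n)"
      proof -
        have "3 - real n = - real (n - 3)" using n by simp
        then have eq: "\<epsilon> powr (3 - real n) = inverse (\<epsilon> ^ (n - 3))"
          using eps by (simp only: powr_minus powr_realpow)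
        show ?thesis by (simp only: eq power_divide) (simp only: divide_inverse)
      qed
      also have "c ^ n * (real ((n + 1) ^ (n + 1) * 2 ^ n)
          * (bracket (x0 - xn) powr ?p * (real n + 1) powr (- ?p))
          * ((q * real n) ^ (n - 3) * \<epsilon> powr (3 - real n)))
        = (c ^ n * real ((n + 1) ^ (n + 1) * 2 ^ n) * (q * real n) ^ (n - 3) * \<epsilon> powr (3 - real n)
          * bracket (x0 - xn) powr ?p) * (real n + 1) powr (- ?p)"
        by (simp only: ac_simps)
      also have "\<dots> \<le> (c ^ n * real ((n + 1) ^ (n + 1) * 2 ^ n) * (q * real n) ^ (n - 3)
          * \<epsilon> powr (3 - real n) * bracket (x0 - xn) powr ?p) * (real n + 1) ^ (3 * ?d)"
      proof (rule mult_left_mono)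
        have "(real n + 1) powr (- ?p) \<le> (real n + 1) powr real (3 * ?d)"
          using eps by (intro powr_mono) auto
        then show "(real n + 1) powr (- ?p) \<le> (real n + 1) ^ (3 * ?d)" by (simp only: powr_realpow)
      qed (use c q in auto)
      also have "\<dots> = (c ^ n * real ((n + 1) ^ (n + 1) * 2 ^ n) * (real n + 1) ^ (3 * ?d)
          * (q * real n) ^ (n - 3)) * \<epsilon> powr (3 - real n) * bracket (x0 - xn) powr ?p"
        by (simp only: ac_simps)
      also have "\<dots> \<le> ?R \<epsilon>"
        unfolding C_def by (intro mult_right_mono combinatorial_factor_le[OF c q n]) auto
      finally show ?thesis .
    qed
    have summable: "?f summable_on ?U"
    proof (rule nonneg_bdd_above_summable_on)
      show "bdd_above (sum ?f ` {X. X \<subseteq> ?U \<and> finite X})"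
        by (rule bdd_aboveI[of _ "?R (1/2)"]) (use fin_sum[of _ "1/2"] in auto)
    qed simp
    have "norm (path_sum K b n ?U x0 xn) \<le> ?R \<epsilon>" if eps: "0 < \<epsilon>" "\<epsilon> < 1" for \<epsilon>
    proof -
      have "norm (path_sum K b n ?U x0 xn) \<le> infsum ?f ?U"
        unfolding path_sum_def by (rule norm_infsum_bound[OF summable])
      also have "\<dots> \<le> ?R \<epsilon>"
        by (rule infsum_le_finite_sums[OF summable]) (rule fin_sum[OF _ _ eps])
      finally show ?thesis .
    qed
    then show ?thesis using summable by blast
  qed
  show ?thesis
    by (rule exI[of _ C], rule conjI[OF C], rule exI[of _ 1], rule conjI[OF zero_less_one])
       (intro allI impI main)
qed

end
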